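(* Let $R$ be a Koszul $\Bbbk$-algebra and let $M$ be a linear $R$-module of finite graded length. Then every element of $\mathcal N_M$ is nilpotent in $\operatorname{Ext}^*_R(M,M)$.
   Context: $\Bbbk$ is a field; modules are right modules. A Koszul $\Bbbk$-algebra is a graded algebra $R=R_0\oplus R_1\oplus\cdots$ with $R_0=\Bbbk\times\cdots\times\Bbbk$ such that $R_0=R/\mathfrak r$, $\mathfrak r=\bigoplus_{i>0}R_i$, is a linear $R$-module. Only graded modules having graded projective resolutions with finitely generated terms are considered. A graded module $M$ generated in degree $0$ is linear if it has a graded projective resolution in which, for each $n$, the $n$-th term is generated in degree $n$. A homomorphism $f\colon M\to N$ of graded modules has degree $i$ if $f(M_k)\subseteq N_{i+k}$ for all $k$. $\operatorname{Ext}^*_R(M,M)=\bigoplus_{n\ge0}\operatorname{Ext}^n_R(M,M)$ is an algebra under the Yoneda product, bigraded by letting $\operatorname{Ext}^n_R(M,M)_i$ be the classes represented by degree $i$ homomorphisms $P^n_M\to M$, where $P_M^\bullet$ is a minimal graded projective resolution of $M$. Define $\mathcal N_M=\bigoplus_{n\ge0}\bigoplus_{i>-n}\operatorname{Ext}^n_R(M,M)_i$. A graded module $M$ has finite graded length $d$ if there are integers $a\le b$ with $M_a\neq0$, $M_b\ne0$, $M_i=0$ for $i<a$ and for $i>b$, and $d=b-a+1$. *)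

theory Defs
  imports "HOL-Algebra.Module" "HOL-Algebra.QuotRing" "HOL-Library.FuncSet"
begin

section \<open>Right modules over a noncommutative ring\<close>

text \<open>The library's \<open>module\<close> locale requires a commutative ring of scalars. As there, the record
  extends \<open>ring\<close> only to inherit the additive notation; the fields \<open>mult\<close> and \<open>one\<close> of a module
  are irrelevant.\<close>

record ('a, 'b) rmodule = "'b ring" +
  rsmult :: "'b \<Rightarrow> 'a \<Rightarrow> 'b" (infixl \<open>\<cdot>\<index>\<close> 70)

locale right_module = R?: ring R + M?: abelian_group M for R (structure) and M (structure) +
  assumes rsmult_closed:
      "\<lbrakk>x \<in> carrier M; r \<in> carrier R\<rbrakk> \<Longrightarrow> x \<cdot>\<^bsub>M\<^esub> r \<in> carrier M"
    and rsmult_add_left: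
      "\<lbrakk>x \<in> carrier M; y \<in> carrier M; r \<in> carrier R\<rbrakk> \<Longrightarrow>
       (x \<oplus>\<^bsub>M\<^esub> y) \<cdot>\<^bsub>M\<^esub> r = x \<cdot>\<^bsub>M\<^esub> r \<oplus>\<^bsub>M\<^esub> y \<cdot>\<^bsub>M\<^esub> r"
    and rsmult_add_right:
      "\<lbrakk>x \<in> carrier M; r \<in> carrier R; s \<in> carrier R\<rbrakk> \<Longrightarrow>
       x \<cdot>\<^bsub>M\<^esub> (r \<oplus>\<^bsub>R\<^esub> s) = x \<cdot>\<^bsub>M\<^esub> r \<oplus>\<^bsub>M\<^esub> x \<cdot>\<^bsub>M\<^esub> s"
    and rsmult_assoc:
      "\<lbrakk>x \<in> carrier M; r \<in> carrier R; s \<in> carrier R\<rbrakk> \<Longrightarrow>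
       x \<cdot>\<^bsub>M\<^esub> (r \<otimes>\<^bsub>R\<^esub> s) = (x \<cdot>\<^bsub>M\<^esub> r) \<cdot>\<^bsub>M\<^esub> s"
    and rsmult_one: "x \<in> carrier M \<Longrightarrow> x \<cdot>\<^bsub>M\<^esub> \<one>\<^bsub>R\<^esub> = x"

definition rmod_hom ::
  "('a, 'r) ring_scheme \<Rightarrow> ('a, 'b, 'm) rmodule_scheme \<Rightarrow> ('a, 'c, 'n) rmodule_scheme \<Rightarrow> ('b \<Rightarrow> 'c) set"
  where "rmod_hom R M N = {f. f \<in> carrier M \<rightarrow> carrier N \<and>
    (\<forall>x\<in>carrier M. \<forall>y\<in>carrier M. f (x \<oplus>\<^bsub>M\<^esub> y) = f x \<oplus>\<^bsub>N\<^esub> f y) \<and>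
    (\<forall>x\<in>carrier M. \<forall>r\<in>carrier R. f (x \<cdot>\<^bsub>M\<^esub> r) = f x \<cdot>\<^bsub>N\<^esub> r)}"

definition rsubmodule ::
  "('a, 'r) ring_scheme \<Rightarrow> ('a, 'b, 'm) rmodule_scheme \<Rightarrow> 'b set \<Rightarrow> bool"
  where "rsubmodule R M N \<longleftrightarrow> additive_subgroup N M \<and> (\<forall>x\<in>N. \<forall>r\<in>carrier R. x \<cdot>\<^bsub>M\<^esub> r \<in> N)"

definition rspan :: "('a, 'r) ring_scheme \<Rightarrow> ('a, 'b, 'm) rmodule_scheme \<Rightarrow> 'b set \<Rightarrow> 'b set"
  where "rspan R M S = \<Inter>{N. rsubmodule R M N \<and> S \<subseteq> N}"

definition finitely_generated :: "('a, 'r) ring_scheme \<Rightarrow> ('a, 'b, 'm) rmodule_scheme \<Rightarrow> bool"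
  where "finitely_generated R M \<longleftrightarrow>
    (\<exists>S. finite S \<and> S \<subseteq> carrier M \<and> rspan R M S = carrier M)"

definition free_rmodule :: "('a, 'r) ring_scheme \<Rightarrow> 'x set \<Rightarrow> ('a, 'x \<Rightarrow> 'a) rmodule"
  where "free_rmodule R X =
    \<lparr>carrier = {f. (\<forall>x. f x \<in> carrier R) \<and> (\<forall>x. x \<notin> X \<longrightarrow> f x = \<zero>\<^bsub>R\<^esub>) \<and> finite {x. f x \<noteq> \<zero>\<^bsub>R\<^esub>}},
     mult = undefined, one = undefined,
     zero = (\<lambda>x. \<zero>\<^bsub>R\<^esub>), add = (\<lambda>f g x. f x \<oplus>\<^bsub>R\<^esub> g x),
     rsmult = (\<lambda>f r x. f x \<otimes>\<^bsub>R\<^esub> r)\<rparr>"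

text \<open>A module is projective if it is (isomorphic to) a direct summand of a free module. The usual
  lifting property would need a quantification over all types of test modules inside the
  definition. Taking the basis in the type of the elements of \<open>P\<close> is no restriction, because \<open>P\<close>
  is a quotient of the free module on its own carrier; see \<open>rprojective_lift\<close> and
  \<open>rprojectiveI_lift\<close> below.\<close>

definition rprojective :: "('a, 'r) ring_scheme \<Rightarrow> ('a, 'b, 'm) rmodule_scheme \<Rightarrow> bool"
  where "rprojective R P \<longleftrightarrow> right_module R P \<and>
    (\<exists>(X :: 'b set) i p. i \<in> rmod_hom R P (free_rmodule R X) \<and> p \<in> rmod_hom R (free_rmodule R X) P \<and>
       (\<forall>x\<in>carrier P. p (i x) = x))"

text \<open>The next lemmas show that projectivity in this sense is the lifting property: it yields
  liftings against surjections between modules of arbitrary types, and it follows from the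
  splitting of all surjections onto \<open>P\<close> from modules of the type of the free module on \<open>carrier P\<close>.\<close>

lemma rmod_homD:
  assumes "f \<in> rmod_hom R M N"
  shows "x \<in> carrier M \<Longrightarrow> f x \<in> carrier N"
    and "\<lbrakk>x \<in> carrier M; y \<in> carrier M\<rbrakk> \<Longrightarrow> f (x \<oplus>\<^bsub>M\<^esub> y) = f x \<oplus>\<^bsub>N\<^esub> f y"
    and "\<lbrakk>x \<in> carrier M; r \<in> carrier R\<rbrakk> \<Longrightarrow> f (x \<cdot>\<^bsub>M\<^esub> r) = f x \<cdot>\<^bsub>N\<^esub> r"
  using assms by (auto simp: rmod_hom_def)

lemma rmod_hom_comp:
  assumes "f \<in> rmod_hom R L M" "g \<in> rmod_hom R M N"
  shows "(\<lambda>x. g (f x)) \<in> rmod_hom R L N"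
  using assms by (auto simp: rmod_hom_def Pi_iff)

context right_module
begin

lemma rsmult_zero_left: "r \<in> carrier R \<Longrightarrow> \<zero>\<^bsub>M\<^esub> \<cdot>\<^bsub>M\<^esub> r = \<zero>\<^bsub>M\<^esub>"
  using rsmult_add_left[of "\<zero>\<^bsub>M\<^esub>" "\<zero>\<^bsub>M\<^esub>" r] rsmult_closed[of "\<zero>\<^bsub>M\<^esub>" r]
  by (metis M.add.r_cancel_one' M.l_zero M.zero_closed)

lemma rsmult_zero_right: "x \<in> carrier M \<Longrightarrow> x \<cdot>\<^bsub>M\<^esub> \<zero>\<^bsub>R\<^esub> = \<zero>\<^bsub>M\<^esub>"
  using rsmult_add_right[of x "\<zero>\<^bsub>R\<^esub>" "\<zero>\<^bsub>R\<^esub>"] rsmult_closed[of x "\<zero>\<^bsub>R\<^esub>"]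
  by (metis M.add.r_cancel_one' R.l_zero R.zero_closed)

lemma finsum_rsmult:
  assumes "finite S" "f \<in> S \<rightarrow> carrier M" "r \<in> carrier R"
  shows "(\<Oplus>\<^bsub>M\<^esub>x\<in>S. f x) \<cdot>\<^bsub>M\<^esub> r = (\<Oplus>\<^bsub>M\<^esub>x\<in>S. f x \<cdot>\<^bsub>M\<^esub> r)"
  using assms
proof (induction S rule: finite_induct)
  case empty
  then show ?case by (simp add: rsmult_zero_left M.finsum_empty)
next
  case (insert a S)
  then have "f \<in> S \<rightarrow> carrier M" "f a \<in> carrier M" "(\<lambda>x. f x \<cdot>\<^bsub>M\<^esub> r) \<in> S \<rightarrow> carrier M"
    by (auto intro!: rsmult_closed)
  with insert show ?case
    by (simp add: rsmult_add_left rsmult_closed)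
qed

end

lemma right_module_free_rmodule:
  fixes R :: "('a, 'r) ring_scheme" and X :: "'x set"
  assumes "ring R" shows "right_module R (free_rmodule R X)"
proof -
  interpret ring R by fact
  have supp_add: "finite {x. f x \<oplus>\<^bsub>R\<^esub> g x \<noteq> \<zero>\<^bsub>R\<^esub>}"
    if "finite {x. f x \<noteq> \<zero>\<^bsub>R\<^esub>}" "finite {x. g x \<noteq> \<zero>\<^bsub>R\<^esub>}" for f g :: "'x \<Rightarrow> 'a"
    by (rule finite_subset[OF _ finite_UnI[OF that]]) auto
  have supp_neg: "finite {x. \<ominus>\<^bsub>R\<^esub> f x \<noteq> \<zero>\<^bsub>R\<^esub>}" if "finite {x. f x \<noteq> \<zero>\<^bsub>R\<^esub>}" for f :: "'x \<Rightarrow> 'a"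
    by (rule finite_subset[OF _ that]) auto
  have supp_mult: "finite {x. f x \<otimes>\<^bsub>R\<^esub> r \<noteq> \<zero>\<^bsub>R\<^esub>}"
    if "finite {x. f x \<noteq> \<zero>\<^bsub>R\<^esub>}" "r \<in> carrier R" for f :: "'x \<Rightarrow> 'a" and r
    by (rule finite_subset[OF _ that(1)]) (use that(2) in auto)
  have "abelian_group (free_rmodule R X)"
  proof (rule abelian_groupI)
    fix f assume "f \<in> carrier (free_rmodule R X)"
    then show "\<exists>g\<in>carrier (free_rmodule R X). g \<oplus>\<^bsub>free_rmodule R X\<^esub> f = \<zero>\<^bsub>free_rmodule R X\<^esub>"
      by (intro bexI[of _ "\<lambda>x. \<ominus>\<^bsub>R\<^esub> f x"]) (simp_all add: free_rmodule_def fun_eq_iff l_neg supp_neg)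
  qed (simp_all add: free_rmodule_def fun_eq_iff a_ac supp_add)
  then show ?thesis
    by (intro right_module.intro right_module_axioms.intro \<open>ring R\<close>)
      (simp_all add: free_rmodule_def fun_eq_iff l_distr r_distr m_assoc supp_mult)
qed

definition free_ext :: "('a, 'b, 'm) rmodule_scheme \<Rightarrow> ('a, 'r) ring_scheme \<Rightarrow> ('x \<Rightarrow> 'b) \<Rightarrow> ('x \<Rightarrow> 'a) \<Rightarrow> 'b"
  where "free_ext N R \<phi> v = (\<Oplus>\<^bsub>N\<^esub>x\<in>{x. v x \<noteq> \<zero>\<^bsub>R\<^esub>}. \<phi> x \<cdot>\<^bsub>N\<^esub> v x)"

lemma free_ext_superset:
  assumes "right_module R N" "\<phi> \<in> X \<rightarrow> carrier N" "v \<in> carrier (free_rmodule R X)"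
    and "finite S" "{x. v x \<noteq> \<zero>\<^bsub>R\<^esub>} \<subseteq> S" "S \<subseteq> X"
  shows "free_ext N R \<phi> v = (\<Oplus>\<^bsub>N\<^esub>x\<in>S. \<phi> x \<cdot>\<^bsub>N\<^esub> v x)"
proof -
  interpret right_module R N by fact
  have v: "v x \<in> carrier R" for x using assms(3) by (auto simp: free_rmodule_def)
  show ?thesis
    unfolding free_ext_def
    by (rule M.add.finprod_mono_neutral_cong_left)
      (use assms(2-) in \<open>auto simp: v Pi_iff subset_iff intro!: rsmult_closed rsmult_zero_right\<close>)
qed

lemma free_ext_hom:
  assumes "right_module R N" "\<phi> \<in> X \<rightarrow> carrier N"
  shows "free_ext N R \<phi> \<in> rmod_hom R (free_rmodule R X) N"
proof -
  interpret right_module R N by fact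
  interpret F: right_module R "free_rmodule R X" by (rule right_module_free_rmodule) unfold_locales
  let ?F = "free_rmodule R X"
  have val: "v x \<in> carrier R" if "v \<in> carrier ?F" for v x
    using that by (auto simp: free_rmodule_def)
  have supp: "finite {x. v x \<noteq> \<zero>\<^bsub>R\<^esub>}" "{x. v x \<noteq> \<zero>\<^bsub>R\<^esub>} \<subseteq> X" if "v \<in> carrier ?F" for v
    using that by (auto simp: free_rmodule_def)
  have cl: "(\<lambda>x. \<phi> x \<cdot>\<^bsub>N\<^esub> v x) \<in> S \<rightarrow> carrier N" if "v \<in> carrier ?F" "S \<subseteq> X" for v S
    using assms(2) that by (auto intro!: rsmult_closed val)
  have 1: "free_ext N R \<phi> v \<in> carrier N" if "v \<in> carrier ?F" for v
    unfolding free_ext_def by (rule M.finsum_closed[OF cl[OF that supp(2)[OF that]]])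
  have 2: "free_ext N R \<phi> (v \<oplus>\<^bsub>?F\<^esub> w) = free_ext N R \<phi> v \<oplus>\<^bsub>N\<^esub> free_ext N R \<phi> w"
    if vw: "v \<in> carrier ?F" "w \<in> carrier ?F" for v w
  proof -
    let ?S = "{x. v x \<noteq> \<zero>\<^bsub>R\<^esub>} \<union> {x. w x \<noteq> \<zero>\<^bsub>R\<^esub>}"
    have S: "finite ?S" "?S \<subseteq> X" using supp[OF vw(1)] supp[OF vw(2)] by auto
    have sub: "{x. (v \<oplus>\<^bsub>?F\<^esub> w) x \<noteq> \<zero>\<^bsub>R\<^esub>} \<subseteq> ?S" by (auto simp: free_rmodule_def)
    have "free_ext N R \<phi> (v \<oplus>\<^bsub>?F\<^esub> w) = (\<Oplus>\<^bsub>N\<^esub>x\<in>?S. \<phi> x \<cdot>\<^bsub>N\<^esub> (v \<oplus>\<^bsub>?F\<^esub> w) x)"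
      using free_ext_superset[OF assms F.M.a_closed[OF vw] S(1) sub S(2)] .
    also have "\<dots> = (\<Oplus>\<^bsub>N\<^esub>x\<in>?S. \<phi> x \<cdot>\<^bsub>N\<^esub> v x \<oplus>\<^bsub>N\<^esub> \<phi> x \<cdot>\<^bsub>N\<^esub> w x)"
    proof (rule M.finsum_cong'[OF refl])
      show "(\<lambda>x. \<phi> x \<cdot>\<^bsub>N\<^esub> v x \<oplus>\<^bsub>N\<^esub> \<phi> x \<cdot>\<^bsub>N\<^esub> w x) \<in> ?S \<rightarrow> carrier N"
        using cl[OF vw(1) S(2)] cl[OF vw(2) S(2)] by (auto simp: Pi_iff)
      show "\<phi> x \<cdot>\<^bsub>N\<^esub> (v \<oplus>\<^bsub>?F\<^esub> w) x = \<phi> x \<cdot>\<^bsub>N\<^esub> v x \<oplus>\<^bsub>N\<^esub> \<phi> x \<cdot>\<^bsub>N\<^esub> w x" if "x \<in> ?S" for x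
      proof -
        have "\<phi> x \<in> carrier N" using funcset_mem[OF assms(2) subsetD[OF S(2) that]] .
        then show ?thesis
          by (simp add: free_rmodule_def rsmult_add_right val[OF vw(1)] val[OF vw(2)])
      qed
    qed
    also have "\<dots> = (\<Oplus>\<^bsub>N\<^esub>x\<in>?S. \<phi> x \<cdot>\<^bsub>N\<^esub> v x) \<oplus>\<^bsub>N\<^esub> (\<Oplus>\<^bsub>N\<^esub>x\<in>?S. \<phi> x \<cdot>\<^bsub>N\<^esub> w x)"
      by (rule M.finsum_addf[OF cl[OF vw(1) S(2)] cl[OF vw(2) S(2)]])
    also have "\<dots> = free_ext N R \<phi> v \<oplus>\<^bsub>N\<^esub> free_ext N R \<phi> w"
      using free_ext_superset[OF assms vw(1) S(1) _ S(2)] free_ext_superset[OF assms vw(2) S(1) _ S(2)]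
      by simp
    finally show ?thesis .
  qed
  have 3: "free_ext N R \<phi> (v \<cdot>\<^bsub>?F\<^esub> r) = free_ext N R \<phi> v \<cdot>\<^bsub>N\<^esub> r"
    if v: "v \<in> carrier ?F" and r: "r \<in> carrier R" for v r
  proof -
    let ?S = "{x. v x \<noteq> \<zero>\<^bsub>R\<^esub>}"
    note S = supp[OF v]
    have sub: "{x. (v \<cdot>\<^bsub>?F\<^esub> r) x \<noteq> \<zero>\<^bsub>R\<^esub>} \<subseteq> ?S" using r by (auto simp: free_rmodule_def)
    have "free_ext N R \<phi> (v \<cdot>\<^bsub>?F\<^esub> r) = (\<Oplus>\<^bsub>N\<^esub>x\<in>?S. \<phi> x \<cdot>\<^bsub>N\<^esub> (v \<cdot>\<^bsub>?F\<^esub> r) x)"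
      using free_ext_superset[OF assms F.rsmult_closed[OF v r] S(1) sub S(2)] .
    also have "\<dots> = (\<Oplus>\<^bsub>N\<^esub>x\<in>?S. (\<phi> x \<cdot>\<^bsub>N\<^esub> v x) \<cdot>\<^bsub>N\<^esub> r)"
    proof (rule M.finsum_cong'[OF refl])
      show "(\<lambda>x. (\<phi> x \<cdot>\<^bsub>N\<^esub> v x) \<cdot>\<^bsub>N\<^esub> r) \<in> ?S \<rightarrow> carrier N"
        using cl[OF v S(2)] r by (auto simp: Pi_iff rsmult_closed)
      show "\<phi> x \<cdot>\<^bsub>N\<^esub> (v \<cdot>\<^bsub>?F\<^esub> r) x = (\<phi> x \<cdot>\<^bsub>N\<^esub> v x) \<cdot>\<^bsub>N\<^esub> r" if "x \<in> ?S" for x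
      proof -
        have "\<phi> x \<in> carrier N" using funcset_mem[OF assms(2) subsetD[OF S(2) that]] .
        then show ?thesis
          by (simp add: free_rmodule_def rsmult_assoc val[OF v] r)
      qed
    qed
    also have "\<dots> = free_ext N R \<phi> v \<cdot>\<^bsub>N\<^esub> r"
      unfolding free_ext_def using finsum_rsmult[OF S(1) cl[OF v S(2)] r] by simp
    finally show ?thesis .
  qed
  show ?thesis using 1 2 3 by (auto simp: rmod_hom_def)
qed

definition free_basis :: "('a, 'r) ring_scheme \<Rightarrow> 'x \<Rightarrow> 'x \<Rightarrow> 'a"
  where "free_basis R x = (\<lambda>y. if y = x then \<one>\<^bsub>R\<^esub> else \<zero>\<^bsub>R\<^esub>)"

lemma free_basis_carrier:
  assumes "ring R" "x \<in> X" shows "free_basis R x \<in> carrier (free_rmodule R X)"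
proof -
  interpret ring R by fact
  have "finite {y. free_basis R x y \<noteq> \<zero>\<^bsub>R\<^esub>}"
    by (rule finite_subset[of _ "{x}"]) (auto simp: free_basis_def)
  then show ?thesis using assms(2) by (auto simp: free_basis_def free_rmodule_def)
qed

lemma free_hom_eq:
  assumes "right_module R N" "q \<in> rmod_hom R (free_rmodule R X) N" "v \<in> carrier (free_rmodule R X)"
  shows "q v = free_ext N R (\<lambda>x. q (free_basis R x)) v"
proof -
  interpret right_module R N by fact
  interpret F: right_module R "free_rmodule R X" by (rule right_module_free_rmodule) unfold_locales
  let ?F = "free_rmodule R X"
  let ?\<phi> = "\<lambda>x. q (free_basis R x)"
  have \<phi>: "?\<phi> \<in> X \<rightarrow> carrier N"
    by (intro funcsetI rmod_homD(1)[OF assms(2)] free_basis_carrier[OF R.ring_axioms])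
  note E = free_ext_hom[OF assms(1) \<phi>]
  have q0: "p \<zero>\<^bsub>?F\<^esub> = \<zero>\<^bsub>N\<^esub>" if "p \<in> rmod_hom R ?F N" for p
    using rmod_homD(2)[OF that F.M.zero_closed F.M.zero_closed] rmod_homD(1)[OF that F.M.zero_closed]
    by (metis F.M.l_zero F.M.zero_closed M.add.r_cancel_one')
  have "\<forall>v\<in>carrier ?F. {x. v x \<noteq> \<zero>\<^bsub>R\<^esub>} = S \<longrightarrow> q v = free_ext N R ?\<phi> v" if "finite S" for S
    using that
  proof (induction S rule: finite_induct)
    case empty
    show ?case
    proof (intro ballI impI)
      fix v assume "v \<in> carrier ?F" "{x. v x \<noteq> \<zero>\<^bsub>R\<^esub>} = {}"
      then have "v = \<zero>\<^bsub>?F\<^esub>" by (auto simp: free_rmodule_def)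
      then show "q v = free_ext N R ?\<phi> v" using q0[OF assms(2)] q0[OF E] by simp
    qed
  next
    case (insert a S)
    show ?case
    proof (intro ballI impI)
      fix v assume v: "v \<in> carrier ?F" and S: "{x. v x \<noteq> \<zero>\<^bsub>R\<^esub>} = insert a S"
      have a: "a \<in> X" "v a \<in> carrier R" using v S by (auto simp: free_rmodule_def)
      let ?w = "v(a := \<zero>\<^bsub>R\<^esub>)" and ?b = "free_basis R a \<cdot>\<^bsub>?F\<^esub> v a"
      have wS: "{x. ?w x \<noteq> \<zero>\<^bsub>R\<^esub>} = S" using S insert(2) by auto
      have w: "?w \<in> carrier ?F" using v wS insert(1) by (auto simp: free_rmodule_def)
      have b: "free_basis R a \<in> carrier ?F" by (rule free_basis_carrier[OF R.ring_axioms a(1)])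
      have b': "?b \<in> carrier ?F" by (rule F.rsmult_closed[OF b a(2)])
      have veq: "v = ?w \<oplus>\<^bsub>?F\<^esub> ?b"
        using v a by (auto simp: free_rmodule_def free_basis_def fun_eq_iff)
      have eb: "free_ext N R ?\<phi> (free_basis R a) = ?\<phi> a"
      proof -
        have sub: "{x. free_basis R a x \<noteq> \<zero>\<^bsub>R\<^esub>} \<subseteq> {a}" by (auto simp: free_basis_def)
        have "free_ext N R ?\<phi> (free_basis R a) = (\<Oplus>\<^bsub>N\<^esub>x\<in>{a}. ?\<phi> x \<cdot>\<^bsub>N\<^esub> free_basis R a x)"
          by (rule free_ext_superset[OF assms(1) \<phi> b _ sub]) (use a in auto)
        also have "\<dots> = ?\<phi> a"
          using \<phi> a by (auto simp: free_basis_def rsmult_one Pi_iff M.finsum_insert M.finsum_empty)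
        finally show ?thesis .
      qed
      have "q v = q ?w \<oplus>\<^bsub>N\<^esub> ?\<phi> a \<cdot>\<^bsub>N\<^esub> v a"
        using rmod_homD(2)[OF assms(2) w b'] rmod_homD(3)[OF assms(2) b a(2)] veq by metis
      moreover have "free_ext N R ?\<phi> v = free_ext N R ?\<phi> ?w \<oplus>\<^bsub>N\<^esub> ?\<phi> a \<cdot>\<^bsub>N\<^esub> v a"
        using rmod_homD(2)[OF E w b'] rmod_homD(3)[OF E b a(2)] veq eb by metis
      moreover have "q ?w = free_ext N R ?\<phi> ?w" using insert.IH w wS by blast
      ultimately show "q v = free_ext N R ?\<phi> v" by simp
    qed
  qed
  moreover have "finite {x. v x \<noteq> \<zero>\<^bsub>R\<^esub>}" using assms(3) by (auto simp: free_rmodule_def)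
  ultimately show ?thesis using assms(3) by blast
qed

lemma rprojective_lift:
  fixes P :: "('a, 'b, 'm) rmodule_scheme"
  assumes P: "rprojective R P" and N: "right_module R N" "right_module R N'"
    and g: "g \<in> rmod_hom R N N'" "g ` carrier N = carrier N'" and f: "f \<in> rmod_hom R P N'"
  shows "\<exists>h\<in>rmod_hom R P N. \<forall>x\<in>carrier P. g (h x) = f x"
proof -
  obtain X :: "'b set" and i p where i: "i \<in> rmod_hom R P (free_rmodule R X)"
    and p: "p \<in> rmod_hom R (free_rmodule R X) P" and pi: "\<And>x. x \<in> carrier P \<Longrightarrow> p (i x) = x"
    using P by (auto simp: rprojective_def)
  have R: "ring R" using N(1) by (rule right_module.axioms)
  let ?\<psi> = "\<lambda>x. f (p (free_basis R x))"
  have \<psi>: "?\<psi> \<in> X \<rightarrow> carrier N'"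
    by (intro funcsetI rmod_homD(1)[OF f] rmod_homD(1)[OF p] free_basis_carrier[OF R])
  have "\<exists>y\<in>carrier N. g y = ?\<psi> x" if "x \<in> X" for x
  proof -
    have "?\<psi> x \<in> g ` carrier N" using funcset_mem[OF \<psi> that] g(2) by simp
    then show ?thesis by (elim imageE) (auto intro: sym)
  qed
  then obtain \<phi> where \<phi>: "\<And>x. x \<in> X \<Longrightarrow> \<phi> x \<in> carrier N" "\<And>x. x \<in> X \<Longrightarrow> g (\<phi> x) = ?\<psi> x"
    by metis
  let ?E = "free_ext N R \<phi>"
  have \<phi>': "\<phi> \<in> X \<rightarrow> carrier N" using \<phi>(1) by blast
  have E: "?E \<in> rmod_hom R (free_rmodule R X) N" by (rule free_ext_hom[OF N(1) \<phi>'])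
  have cong: "free_ext N' R a v = free_ext N' R b v"
    if v: "v \<in> carrier (free_rmodule R X)" and ab: "\<And>x. x \<in> X \<Longrightarrow> a x = b x" "b \<in> X \<rightarrow> carrier N'"
    for a b v
  proof -
    interpret right_module R N' by fact
    have X: "x \<in> X" if "v x \<noteq> \<zero>\<^bsub>R\<^esub>" for x
      using v that by (auto simp: free_rmodule_def)
    show ?thesis unfolding free_ext_def
      by (rule M.finsum_cong'[OF refl])
        (use v ab X in \<open>auto simp: free_rmodule_def Pi_iff intro!: rsmult_closed\<close>)
  qed
  have gE: "g (?E (free_basis R x)) = ?\<psi> x" if "x \<in> X" for x
  proof -
    interpret right_module R N by fact
    have sub: "{y. free_basis R x y \<noteq> \<zero>\<^bsub>R\<^esub>} \<subseteq> {x}" by (auto simp: free_basis_def)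
    have "?E (free_basis R x) = (\<Oplus>\<^bsub>N\<^esub>y\<in>{x}. \<phi> y \<cdot>\<^bsub>N\<^esub> free_basis R x y)"
      by (rule free_ext_superset[OF N(1) \<phi>' free_basis_carrier[OF R that] _ sub]) (use that in auto)
    also have "\<dots> = \<phi> x"
      using \<phi>(1)[OF that] by (auto simp: free_basis_def rsmult_one M.finsum_insert M.finsum_empty)
    finally show ?thesis using \<phi>(2)[OF that] by simp
  qed
  have key: "g (?E v) = f (p v)" if v: "v \<in> carrier (free_rmodule R X)" for v
    using free_hom_eq[OF N(2) rmod_hom_comp[OF E g(1)] v]
      free_hom_eq[OF N(2) rmod_hom_comp[OF p f] v]
      cong[OF v gE \<psi>] by simp
  show ?thesis
  proof (intro bexI ballI)
    show "(\<lambda>x. ?E (i x)) \<in> rmod_hom R P N" by (rule rmod_hom_comp[OF i E])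
    show "g (?E (i x)) = f x" if "x \<in> carrier P" for x
      using key[OF rmod_homD(1)[OF i that]] pi[OF that] by simp
  qed
qed

lemma rprojectiveI_lift:
  fixes P :: "('a, 'b, 'm) rmodule_scheme"
  assumes P: "right_module R P"
    and lift: "\<And>(N :: ('a, 'b \<Rightarrow> 'a) rmodule) g. \<lbrakk>right_module R N; g \<in> rmod_hom R N P;
      g ` carrier N = carrier P\<rbrakk> \<Longrightarrow> \<exists>h\<in>rmod_hom R P N. \<forall>x\<in>carrier P. g (h x) = x"
  shows "rprojective R P"
proof -
  interpret right_module R P by fact
  let ?F = "free_rmodule R (carrier P)" and ?g = "free_ext P R (\<lambda>x. x)"
  have F: "right_module R ?F" by (rule right_module_free_rmodule[OF R.ring_axioms])
  have g: "?g \<in> rmod_hom R ?F P" by (rule free_ext_hom[OF P]) auto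
  have "x \<in> ?g ` carrier ?F" if "x \<in> carrier P" for x
  proof
    show b: "free_basis R x \<in> carrier ?F" by (rule free_basis_carrier[OF R.ring_axioms that])
    have sub: "{y. free_basis R x y \<noteq> \<zero>\<^bsub>R\<^esub>} \<subseteq> {x}" by (auto simp: free_basis_def)
    have "?g (free_basis R x) = (\<Oplus>\<^bsub>P\<^esub>y\<in>{x}. y \<cdot>\<^bsub>P\<^esub> free_basis R x y)"
      by (rule free_ext_superset[OF P _ b _ sub]) (use that in auto)
    then show "x = ?g (free_basis R x)"
      using that by (simp add: free_basis_def rsmult_one M.finsum_insert M.finsum_empty)
  qed
  then have "?g ` carrier ?F = carrier P" using rmod_homD(1)[OF g] by blast
  from lift[OF F g this] obtain h where "h \<in> rmod_hom R P ?F" "\<forall>x\<in>carrier P. ?g (h x) = x" by blast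
  then show ?thesis unfolding rprojective_def using P g by blast
qed



section \<open>Gradings\<close>

text \<open>\<open>component_sum G A I\<close> is the sum of the subgroups \<open>A i\<close> for \<open>i \<in> I\<close>.\<close>

definition component_sum :: "('a, 'g) ring_scheme \<Rightarrow> ('i \<Rightarrow> 'a set) \<Rightarrow> 'i set \<Rightarrow> 'a set"
  where "component_sum G A I =
    {(\<Oplus>\<^bsub>G\<^esub>i\<in>S. c i) |S c. finite S \<and> S \<subseteq> I \<and> (\<forall>i\<in>S. c i \<in> A i)}"

definition internal_direct_sum :: "('a, 'g) ring_scheme \<Rightarrow> ('i \<Rightarrow> 'a set) \<Rightarrow> bool"
  where "internal_direct_sum G A \<longleftrightarrow> (\<forall>i. additive_subgroup (A i) G) \<and>
    (\<forall>x\<in>carrier G. \<exists>!c. (\<forall>i. c i \<in> A i) \<and> finite {i. c i \<noteq> \<zero>\<^bsub>G\<^esub>} \<and>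
       x = (\<Oplus>\<^bsub>G\<^esub>i\<in>{i. c i \<noteq> \<zero>\<^bsub>G\<^esub>}. c i))"

record ('k, 'a) gralg = "('k, 'a) module" +
  hcomp :: "nat \<Rightarrow> 'a set"

definition graded_algebra :: "('k, 'l) ring_scheme \<Rightarrow> ('k, 'a, 'r) gralg_scheme \<Rightarrow> bool"
  where "graded_algebra K R \<longleftrightarrow> field K \<and> module K R \<and> ring R \<and>
    (\<forall>c\<in>carrier K. \<forall>x\<in>carrier R. \<forall>y\<in>carrier R.
       (c \<odot>\<^bsub>R\<^esub> x) \<otimes>\<^bsub>R\<^esub> y = c \<odot>\<^bsub>R\<^esub> (x \<otimes>\<^bsub>R\<^esub> y) \<and> x \<otimes>\<^bsub>R\<^esub> (c \<odot>\<^bsub>R\<^esub> y) = c \<odot>\<^bsub>R\<^esub> (x \<otimes>\<^bsub>R\<^esub> y)) \<and>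
    internal_direct_sum R (hcomp R) \<and>
    (\<forall>i. \<forall>c\<in>carrier K. \<forall>x\<in>hcomp R i. c \<odot>\<^bsub>R\<^esub> x \<in> hcomp R i) \<and>
    \<one>\<^bsub>R\<^esub> \<in> hcomp R 0 \<and>
    (\<forall>i j. \<forall>x\<in>hcomp R i. \<forall>y\<in>hcomp R j. x \<otimes>\<^bsub>R\<^esub> y \<in> hcomp R (i + j))"

text \<open>\<open>R\<^sub>0\<close> is isomorphic, as a \<open>K\<close>-algebra, to a product of finitely many copies of \<open>K\<close>.\<close>

definition degree_zero_split :: "('k, 'l) ring_scheme \<Rightarrow> ('k, 'a, 'r) gralg_scheme \<Rightarrow> bool"
  where "degree_zero_split K R \<longleftrightarrow>
    (\<exists>n \<phi>. 1 \<le> n \<and> bij_betw \<phi> (hcomp R 0) ({..<n::nat} \<rightarrow>\<^sub>E carrier K) \<and>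
      (\<forall>j<n. \<phi> \<one>\<^bsub>R\<^esub> j = \<one>\<^bsub>K\<^esub>) \<and>
      (\<forall>x\<in>hcomp R 0. \<forall>y\<in>hcomp R 0. \<forall>j<n.
         \<phi> (x \<oplus>\<^bsub>R\<^esub> y) j = \<phi> x j \<oplus>\<^bsub>K\<^esub> \<phi> y j \<and> \<phi> (x \<otimes>\<^bsub>R\<^esub> y) j = \<phi> x j \<otimes>\<^bsub>K\<^esub> \<phi> y j) \<and>
      (\<forall>c\<in>carrier K. \<forall>x\<in>hcomp R 0. \<forall>j<n. \<phi> (c \<odot>\<^bsub>R\<^esub> x) j = c \<otimes>\<^bsub>K\<^esub> \<phi> x j))"

definition aug_ideal :: "('k, 'a, 'r) gralg_scheme \<Rightarrow> 'a set"
  where "aug_ideal R = component_sum R (hcomp R) {i. 0 < i}"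

record ('a, 'b) grmodule = "('a, 'b) rmodule" +
  gcomp :: "int \<Rightarrow> 'b set"

definition graded_module :: "('k, 'a, 'r) gralg_scheme \<Rightarrow> ('a, 'b, 'm) grmodule_scheme \<Rightarrow> bool"
  where "graded_module R M \<longleftrightarrow> right_module R M \<and> internal_direct_sum M (gcomp M) \<and>
    (\<forall>i j. \<forall>x\<in>gcomp M i. \<forall>r\<in>hcomp R j. x \<cdot>\<^bsub>M\<^esub> r \<in> gcomp M (i + int j))"

definition hom_degree ::
  "('a, 'b, 'm) grmodule_scheme \<Rightarrow> ('a, 'c, 'n) grmodule_scheme \<Rightarrow> int \<Rightarrow> ('b \<Rightarrow> 'c) \<Rightarrow> bool"
  where "hom_degree M N i f \<longleftrightarrow> (\<forall>k. f ` gcomp M k \<subseteq> gcomp N (i + k))"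

definition generated_in_degree ::
  "('k, 'a, 'r) gralg_scheme \<Rightarrow> ('a, 'b, 'm) grmodule_scheme \<Rightarrow> int \<Rightarrow> bool"
  where "generated_in_degree R M n \<longleftrightarrow> rspan R M (gcomp M n) = carrier M"

definition graded_length :: "('a, 'b, 'm) grmodule_scheme \<Rightarrow> nat \<Rightarrow> bool"
  where "graded_length M d \<longleftrightarrow>
    (\<exists>a b. a \<le> b \<and> gcomp M a \<noteq> {\<zero>\<^bsub>M\<^esub>} \<and> gcomp M b \<noteq> {\<zero>\<^bsub>M\<^esub>} \<and>
       (\<forall>i. i < a \<or> b < i \<longrightarrow> gcomp M i = {\<zero>\<^bsub>M\<^esub>}) \<and> int d = b - a + 1)"

definition residue_module :: "('k, 'a, 'r) gralg_scheme \<Rightarrow> ('a, 'a set) grmodule"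
  where "residue_module R = (let Q = R Quot aug_ideal R in
    \<lparr>carrier = carrier Q, mult = mult Q, one = one Q, zero = zero Q, add = add Q,
     rsmult = (\<lambda>A r. A \<otimes>\<^bsub>Q\<^esub> (aug_ideal R +>\<^bsub>R\<^esub> r)),
     gcomp = (\<lambda>i. if i = 0 then carrier Q else {\<zero>\<^bsub>Q\<^esub>})\<rparr>)"


section \<open>Projective resolutions, linear modules, Koszul algebras\<close>

text \<open>A resolution consists of the terms \<open>P n\<close>, the differentials \<open>d n : P (n + 1) \<rightarrow> P n\<close> and the
  augmentation \<open>e : P 0 \<rightarrow> M\<close>. Following the convention that only modules admitting graded
  projective resolutions with finitely generated terms are considered, the terms are required to
  be finitely generated.\<close>

definition graded_projective_resolution ::
  "('k, 'a, 'r) gralg_scheme \<Rightarrow> ('a, 'b, 'm) grmodule_scheme \<Rightarrow> (nat \<Rightarrow> ('a, 'p, 'q) grmodule_scheme) \<Rightarrow>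
   (nat \<Rightarrow> 'p \<Rightarrow> 'p) \<Rightarrow> ('p \<Rightarrow> 'b) \<Rightarrow> bool"
  where "graded_projective_resolution R M P d e \<longleftrightarrow>
    (\<forall>n. graded_module R (P n) \<and> rprojective R (P n) \<and> finitely_generated R (P n)) \<and>
    (\<forall>n. d n \<in> rmod_hom R (P (Suc n)) (P n) \<and> hom_degree (P (Suc n)) (P n) 0 (d n)) \<and>
    e \<in> rmod_hom R (P 0) M \<and> hom_degree (P 0) M 0 e \<and>
    e ` carrier (P 0) = carrier M \<and>
    d 0 ` carrier (P (Suc 0)) = a_kernel (P 0) M e \<and>
    (\<forall>n. d (Suc n) ` carrier (P (Suc (Suc n))) = a_kernel (P (Suc n)) (P n) (d n))"

text \<open>Minimality: the image of each differential lies in \<open>P n \<rr>\<close>, where \<open>\<rr>\<close> is the ideal of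
  elements of positive degree.\<close>

definition minimal_graded_projective_resolution ::
  "('k, 'a, 'r) gralg_scheme \<Rightarrow> ('a, 'b, 'm) grmodule_scheme \<Rightarrow> (nat \<Rightarrow> ('a, 'p, 'q) grmodule_scheme) \<Rightarrow>
   (nat \<Rightarrow> 'p \<Rightarrow> 'p) \<Rightarrow> ('p \<Rightarrow> 'b) \<Rightarrow> bool"
  where "minimal_graded_projective_resolution R M P d e \<longleftrightarrow>
    graded_projective_resolution R M P d e \<and>
    (\<forall>n. d n ` carrier (P (Suc n)) \<subseteq>
       rspan R (P n) {x \<cdot>\<^bsub>P n\<^esub> r |x r. x \<in> carrier (P n) \<and> r \<in> aug_ideal R})"

text \<open>The type argument is the type of the elements of the terms of the linear resolution. As a
  hypothesis of a theorem in which \<open>'p\<close> is a free type variable, \<open>linear_module TYPE('p) R M\<close>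
  allows terms of arbitrary type.\<close>

definition linear_module ::
  "'p itself \<Rightarrow> ('k, 'a, 'r) gralg_scheme \<Rightarrow> ('a, 'b, 'm) grmodule_scheme \<Rightarrow> bool"
  where "linear_module _ R M \<longleftrightarrow> graded_module R M \<and> generated_in_degree R M 0 \<and>
    (\<exists>(P :: nat \<Rightarrow> ('a, 'p) grmodule) d e.
       graded_projective_resolution R M P d e \<and> (\<forall>n. generated_in_degree R (P n) (int n)))"

definition koszul_algebra ::
  "'p itself \<Rightarrow> ('k, 'l) ring_scheme \<Rightarrow> ('k, 'a, 'r) gralg_scheme \<Rightarrow> bool"
  where "koszul_algebra T K R \<longleftrightarrow> graded_algebra K R \<and> degree_zero_split K R \<and>
    linear_module T R (residue_module R)"


section \<open>The Ext algebra\<close>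

text \<open>Everything is computed from a fixed projective resolution \<open>P\<close>, \<open>d\<close>, \<open>e\<close> of \<open>M\<close>. Functions are
  compared on carriers only, so a class contains all functions that agree on \<open>carrier (P n)\<close>
  with one of its members.\<close>

definition ext_cocycles ::
  "('a, 'r) ring_scheme \<Rightarrow> ('a, 'b, 'm) rmodule_scheme \<Rightarrow> (nat \<Rightarrow> ('a, 'p, 'q) rmodule_scheme) \<Rightarrow>
   (nat \<Rightarrow> 'p \<Rightarrow> 'p) \<Rightarrow> nat \<Rightarrow> ('p \<Rightarrow> 'b) set"
  where "ext_cocycles R M P d n =
    {f \<in> rmod_hom R (P n) M. \<forall>x\<in>carrier (P (Suc n)). f (d n x) = \<zero>\<^bsub>M\<^esub>}"

definition ext_coboundaries ::
  "('a, 'r) ring_scheme \<Rightarrow> ('a, 'b, 'm) rmodule_scheme \<Rightarrow> (nat \<Rightarrow> ('a, 'p, 'q) rmodule_scheme) \<Rightarrow>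
   (nat \<Rightarrow> 'p \<Rightarrow> 'p) \<Rightarrow> nat \<Rightarrow> ('p \<Rightarrow> 'b) set"
  where "ext_coboundaries R M P d n = (case n of
      0 \<Rightarrow> {\<lambda>x. \<zero>\<^bsub>M\<^esub>}
    | Suc m \<Rightarrow> {\<lambda>x. h (d m x) |h. h \<in> rmod_hom R (P m) M})"

definition ext_rel ::
  "('a, 'r) ring_scheme \<Rightarrow> ('a, 'b, 'm) rmodule_scheme \<Rightarrow> (nat \<Rightarrow> ('a, 'p, 'q) rmodule_scheme) \<Rightarrow>
   (nat \<Rightarrow> 'p \<Rightarrow> 'p) \<Rightarrow> nat \<Rightarrow> (('p \<Rightarrow> 'b) \<times> ('p \<Rightarrow> 'b)) set"
  where "ext_rel R M P d n =
    {(f, g). f \<in> ext_cocycles R M P d n \<and> g \<in> ext_cocycles R M P d n \<and>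
       (\<exists>b\<in>ext_coboundaries R M P d n. \<forall>x\<in>carrier (P n). f x = g x \<oplus>\<^bsub>M\<^esub> b x)}"

definition ext_class ::
  "('a, 'r) ring_scheme \<Rightarrow> ('a, 'b, 'm) rmodule_scheme \<Rightarrow> (nat \<Rightarrow> ('a, 'p, 'q) rmodule_scheme) \<Rightarrow>
   (nat \<Rightarrow> 'p \<Rightarrow> 'p) \<Rightarrow> nat \<Rightarrow> ('p \<Rightarrow> 'b) \<Rightarrow> ('p \<Rightarrow> 'b) set"
  where "ext_class R M P d n f = ext_rel R M P d n `` {f}"

text \<open>Operations on classes are written as unions over all representatives (and, for the product,
  over all liftings); all sets in such a union coincide. The group \<open>Ext\<^sup>n\<close> is an additive group
  only, hence the unspecified \<open>mult\<close> and \<open>one\<close>.\<close>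

definition ext_group ::
  "('a, 'r) ring_scheme \<Rightarrow> ('a, 'b, 'm) rmodule_scheme \<Rightarrow> (nat \<Rightarrow> ('a, 'p, 'q) rmodule_scheme) \<Rightarrow>
   (nat \<Rightarrow> 'p \<Rightarrow> 'p) \<Rightarrow> nat \<Rightarrow> ('p \<Rightarrow> 'b) set ring"
  where "ext_group R M P d n =
    \<lparr>carrier = ext_cocycles R M P d n // ext_rel R M P d n,
     mult = undefined, one = undefined,
     zero = ext_class R M P d n (\<lambda>x. \<zero>\<^bsub>M\<^esub>),
     add = (\<lambda>A B. \<Union>f\<in>A. \<Union>g\<in>B. ext_class R M P d n (\<lambda>x. f x \<oplus>\<^bsub>M\<^esub> g x))\<rparr>"

definition chain_lifts ::
  "('a, 'r) ring_scheme \<Rightarrow> (nat \<Rightarrow> ('a, 'p, 'q) rmodule_scheme) \<Rightarrow>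
   (nat \<Rightarrow> 'p \<Rightarrow> 'p) \<Rightarrow> ('p \<Rightarrow> 'b) \<Rightarrow> nat \<Rightarrow> ('p \<Rightarrow> 'b) \<Rightarrow> (nat \<Rightarrow> 'p \<Rightarrow> 'p) set"
  where "chain_lifts R P d e n f =
    {F. (\<forall>k. F k \<in> rmod_hom R (P (n + k)) (P k)) \<and>
        (\<forall>x\<in>carrier (P n). e (F 0 x) = f x) \<and>
        (\<forall>k. \<forall>x\<in>carrier (P (n + Suc k)). d k (F (Suc k) x) = F k (d (n + k) x))}"

definition yoneda ::
  "('a, 'r) ring_scheme \<Rightarrow> ('a, 'b, 'm) rmodule_scheme \<Rightarrow> (nat \<Rightarrow> ('a, 'p, 'q) rmodule_scheme) \<Rightarrow>
   (nat \<Rightarrow> 'p \<Rightarrow> 'p) \<Rightarrow> ('p \<Rightarrow> 'b) \<Rightarrow> nat \<Rightarrow> nat \<Rightarrow> ('p \<Rightarrow> 'b) set \<Rightarrow> ('p \<Rightarrow> 'b) set \<Rightarrow> ('p \<Rightarrow> 'b) set"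
  where "yoneda R M P d e m n A B =
    (\<Union>g\<in>A. \<Union>f\<in>B. \<Union>F\<in>chain_lifts R P d e n f. ext_class R M P d (n + m) (\<lambda>x. g (F m x)))"

definition ext_algebra ::
  "('a, 'r) ring_scheme \<Rightarrow> ('a, 'b, 'm) rmodule_scheme \<Rightarrow> (nat \<Rightarrow> ('a, 'p, 'q) rmodule_scheme) \<Rightarrow>
   (nat \<Rightarrow> 'p \<Rightarrow> 'p) \<Rightarrow> ('p \<Rightarrow> 'b) \<Rightarrow> (nat \<Rightarrow> ('p \<Rightarrow> 'b) set) ring"
  where "ext_algebra R M P d e =
    \<lparr>carrier = {\<xi>. (\<forall>n. \<xi> n \<in> carrier (ext_group R M P d n)) \<and>
                    finite {n. \<xi> n \<noteq> \<zero>\<^bsub>ext_group R M P d n\<^esub>}},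
     mult = (\<lambda>\<xi> \<eta> n. \<Oplus>\<^bsub>ext_group R M P d n\<^esub>m\<in>{..n}. yoneda R M P d e m (n - m) (\<xi> m) (\<eta> (n - m))),
     one = (\<lambda>n. if n = 0 then ext_class R M P d 0 e else \<zero>\<^bsub>ext_group R M P d n\<^esub>),
     zero = (\<lambda>n. \<zero>\<^bsub>ext_group R M P d n\<^esub>),
     add = (\<lambda>\<xi> \<eta> n. \<xi> n \<oplus>\<^bsub>ext_group R M P d n\<^esub> \<eta> n)\<rparr>"

definition ext_degree ::
  "('a, 'r) ring_scheme \<Rightarrow> ('a, 'b, 'm) grmodule_scheme \<Rightarrow> (nat \<Rightarrow> ('a, 'p, 'q) grmodule_scheme) \<Rightarrow>
   (nat \<Rightarrow> 'p \<Rightarrow> 'p) \<Rightarrow> nat \<Rightarrow> int \<Rightarrow> ('p \<Rightarrow> 'b) set set"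
  where "ext_degree R M P d n i =
    {ext_class R M P d n f |f. f \<in> ext_cocycles R M P d n \<and> hom_degree (P n) M i f}"

definition ext_N ::
  "('a, 'r) ring_scheme \<Rightarrow> ('a, 'b, 'm) grmodule_scheme \<Rightarrow> (nat \<Rightarrow> ('a, 'p, 'q) grmodule_scheme) \<Rightarrow>
   (nat \<Rightarrow> 'p \<Rightarrow> 'p) \<Rightarrow> ('p \<Rightarrow> 'b) \<Rightarrow> (nat \<Rightarrow> ('p \<Rightarrow> 'b) set) set"
  where "ext_N R M P d e =
    {\<xi> \<in> carrier (ext_algebra R M P d e).
       \<forall>n. \<xi> n \<in> component_sum (ext_group R M P d n) (ext_degree R M P d n) {i. - int n < i}}"

end

theory Submission
  imports Defs
begin

text \<open>
  Give a class in \<open>Ext\<^sup>n\<close> of degree \<open>i\<close> the weight \<open>n + i\<close>. Weights add up under the Yoneda product and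
  \<open>\<N>\<^sub>M\<close> consists of sums of classes of weight at least 1, so the \<open>k\<close>-th power of an element has weight
  at least \<open>k\<close>. If the \<open>n\<close>-th term of the resolution is generated in degree \<open>n\<close>, a cocycle of weight
  \<open>w\<close> is determined by its values in \<open>M\<^sub>w\<close>, hence zero when \<open>w\<close> exceeds the top degree of \<open>M\<close>. For the
  given resolution \<open>P\<close> this is transported from a linear resolution \<open>Q\<close>: the composite
  \<open>P \<rightarrow> Q \<rightarrow> P\<close> of comparison maps is homotopic to the identity.

  Instead of the weight grading we use the filtration by weight \<open>\<ge> w\<close>, which is closed under sums, so
  that products of inhomogeneous elements need not be expanded.
\<close>

section \<open>Direct sum decompositions\<close>

lemma additive_subgroupI':
  assumes "abelian_group G" "S \<subseteq> carrier G" "\<zero>\<^bsub>G\<^esub> \<in> S"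
    and "\<And>x y. \<lbrakk>x \<in> S; y \<in> S\<rbrakk> \<Longrightarrow> x \<oplus>\<^bsub>G\<^esub> y \<in> S"
    and "\<And>x. x \<in> S \<Longrightarrow> \<ominus>\<^bsub>G\<^esub> x \<in> S"
  shows "additive_subgroup S G"
proof -
  interpret abelian_group G by fact
  show ?thesis
    by (intro additive_subgroupI subgroup.intro)
      (use assms(2-) in \<open>auto simp: a_inv_def[symmetric]\<close>)
qed

lemma additive_subgroup_finsum:
  assumes "abelian_group G" "additive_subgroup S G" "f \<in> I \<rightarrow> S"
  shows "finsum G f I \<in> S"
proof -
  interpret abelian_group G by fact
  interpret S: additive_subgroup S G by fact
  show ?thesis using assms(3)
  proof (induction I rule: infinite_finite_induct)
    case (insert i I)
    then have "f \<in> I \<rightarrow> carrier G" "f i \<in> carrier G" using S.a_subset by blast+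
    with insert show ?case by (simp add: Pi_iff)
  qed auto
qed

lemma additive_subgroup_eq:
  assumes "abelian_group_hom G H f" "abelian_group_hom G H g"
  shows "additive_subgroup {x \<in> carrier G. f x = g x} G"
proof -
  interpret f: abelian_group_hom G H f by fact
  interpret g: abelian_group_hom G H g by fact
  show ?thesis
    by (rule additive_subgroupI') (auto simp: f.G.abelian_group_axioms)
qed

lemma additive_subgroup_vimage:
  assumes "abelian_group_hom G H f" "additive_subgroup S H"
  shows "additive_subgroup {x \<in> carrier G. f x \<in> S} G"
proof -
  interpret f: abelian_group_hom G H f by fact
  interpret S: additive_subgroup S H by fact
  show ?thesis
    by (rule additive_subgroupI') (auto simp: f.G.abelian_group_axioms)
qed

text \<open>Serves as induction over a grading: a condition that cuts out an additive subgroup holds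
  on all of \<open>G\<close> once it holds on every component. Identities between additive maps are
  checked this way, with \<open>S\<close> the set where they hold.\<close>

lemma internal_direct_sum_subset:
  assumes "abelian_group G" "internal_direct_sum G A" "additive_subgroup S G" "\<And>i. A i \<subseteq> S"
  shows "carrier G \<subseteq> S"
proof
  fix x assume "x \<in> carrier G"
  then obtain c where c: "\<forall>i. c i \<in> A i" "x = (\<Oplus>\<^bsub>G\<^esub>i\<in>{i. c i \<noteq> \<zero>\<^bsub>G\<^esub>}. c i)"
    using assms(2) by (auto simp: internal_direct_sum_def elim!: ballE dest: ex1_implies_ex)
  show "x \<in> S" unfolding c(2)
    by (rule additive_subgroup_finsum[OF assms(1,3)]) (use c(1) assms(4) in auto)
qed

lemma component_sum_subset:
  assumes "abelian_group G" "additive_subgroup S G" "\<And>i. i \<in> I \<Longrightarrow> A i \<subseteq> S"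
  shows "component_sum G A I \<subseteq> S"
  using assms(3) by (auto simp: component_sum_def intro!: additive_subgroup_finsum[OF assms(1,2)])

lemma component_subset_component_sum:
  assumes "abelian_group G" "A i \<subseteq> carrier G" "i \<in> I"
  shows "A i \<subseteq> component_sum G A I"
proof
  fix x assume "x \<in> A i"
  interpret abelian_group G by fact
  have "x = (\<Oplus>\<^bsub>G\<^esub>j\<in>{i}. x)" using \<open>x \<in> A i\<close> assms(2) by (simp add: finsum_insert subset_iff)
  then show "x \<in> component_sum G A I"
    unfolding component_sum_def using \<open>x \<in> A i\<close> assms(3)
    by (intro CollectI exI[of _ "{i}"] exI[of _ "\<lambda>_. x"]) auto
qed

lemma additive_subgroup_component_sum:
  assumes "abelian_group G" "\<And>i. additive_subgroup (A i) G"
  shows "additive_subgroup (component_sum G A I) G"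
proof -
  interpret abelian_group G by fact
  have sub: "A i \<subseteq> carrier G" for i using assms(2) by (rule additive_subgroup.a_subset)
  have zero: "\<zero>\<^bsub>G\<^esub> \<in> A i" for i using assms(2) by (rule additive_subgroup.zero_closed)
  show ?thesis
  proof (rule additive_subgroupI'[OF assms(1)])
    show "component_sum G A I \<subseteq> carrier G"
      using sub by (fastforce simp: component_sum_def intro!: finsum_closed)
    show "\<zero>\<^bsub>G\<^esub> \<in> component_sum G A I"
      unfolding component_sum_def by (intro CollectI exI[of _ "{}"]) auto
  next
    fix x y assume "x \<in> component_sum G A I" "y \<in> component_sum G A I"
    then obtain S T a b where S: "finite S" "S \<subseteq> I" "\<forall>i\<in>S. a i \<in> A i" "x = (\<Oplus>\<^bsub>G\<^esub>i\<in>S. a i)"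
      and T: "finite T" "T \<subseteq> I" "\<forall>i\<in>T. b i \<in> A i" "y = (\<Oplus>\<^bsub>G\<^esub>i\<in>T. b i)"
      by (auto simp: component_sum_def)
    \<comment> \<open>Padding with zeros gives both sums the same index set, so that they can be
      added termwise.\<close>
    define a' where "a' i = (if i \<in> S then a i else \<zero>\<^bsub>G\<^esub>)" for i
    define b' where "b' i = (if i \<in> T then b i else \<zero>\<^bsub>G\<^esub>)" for i
    have ab: "a' i \<in> A i" "b' i \<in> A i" for i using S(3) T(3) zero by (auto simp: a'_def b'_def)
    have abc: "a' \<in> S \<union> T \<rightarrow> carrier G" "b' \<in> S \<union> T \<rightarrow> carrier G" using ab sub by blast+
    have "x = (\<Oplus>\<^bsub>G\<^esub>i\<in>S \<union> T. a' i)" unfolding S(4)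
      by (rule add.finprod_mono_neutral_cong_left) (use S(1) T(1) ab sub in \<open>auto simp: a'_def\<close>)
    moreover have "y = (\<Oplus>\<^bsub>G\<^esub>i\<in>S \<union> T. b' i)" unfolding T(4)
      by (rule add.finprod_mono_neutral_cong_left) (use S(1) T(1) ab sub in \<open>auto simp: b'_def\<close>)
    ultimately have "x \<oplus>\<^bsub>G\<^esub> y = (\<Oplus>\<^bsub>G\<^esub>i\<in>S \<union> T. a' i \<oplus>\<^bsub>G\<^esub> b' i)"
      using finsum_addf[of a' "S \<union> T" b'] abc by simp
    then show "x \<oplus>\<^bsub>G\<^esub> y \<in> component_sum G A I"
      unfolding component_sum_def using S(1,2) T(1,2) ab additive_subgroup.a_closed[OF assms(2)]
      by (intro CollectI exI[of _ "S \<union> T"] exI[of _ "\<lambda>i. a' i \<oplus>\<^bsub>G\<^esub> b' i"]) auto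
  next
    fix x assume "x \<in> component_sum G A I"
    then obtain S a where S: "finite S" "S \<subseteq> I" "\<forall>i\<in>S. a i \<in> A i" "x = (\<Oplus>\<^bsub>G\<^esub>i\<in>S. a i)"
      by (auto simp: component_sum_def)
    have aG: "a \<in> S \<rightarrow> carrier G" "(\<lambda>i. \<ominus>\<^bsub>G\<^esub> a i) \<in> S \<rightarrow> carrier G" using S(3) sub by auto
    have "(\<Oplus>\<^bsub>G\<^esub>i\<in>S. \<ominus>\<^bsub>G\<^esub> a i) \<oplus>\<^bsub>G\<^esub> x = (\<Oplus>\<^bsub>G\<^esub>i\<in>S. \<ominus>\<^bsub>G\<^esub> a i \<oplus>\<^bsub>G\<^esub> a i)"
      unfolding S(4) using finsum_addf[OF aG(2,1)] by simp
    also have "\<dots> = (\<Oplus>\<^bsub>G\<^esub>i\<in>S. \<zero>\<^bsub>G\<^esub>)"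
      by (rule finsum_cong'[OF refl]) (use aG(1) in \<open>auto simp: l_neg Pi_iff\<close>)
    finally have "\<ominus>\<^bsub>G\<^esub> x = (\<Oplus>\<^bsub>G\<^esub>i\<in>S. \<ominus>\<^bsub>G\<^esub> a i)"
      using minus_equality[OF _ finsum_closed[OF aG(1)] finsum_closed[OF aG(2)]] S(4)
      by (simp add: finsum_zero)
    then show "\<ominus>\<^bsub>G\<^esub> x \<in> component_sum G A I"
      unfolding component_sum_def using S(1-3) additive_subgroup.a_inv_closed[OF assms(2)]
      by (intro CollectI exI[of _ S] exI[of _ "\<lambda>i. \<ominus>\<^bsub>G\<^esub> a i"]) auto
  qed
qed

text \<open>Universal property of the direct sum: additive maps on the components glue because each
  element has exactly one finitely supported decomposition. It produces truncations and the
  degreewise correction of a lift.\<close>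

lemma internal_direct_sum_extend:
  assumes "abelian_group G" "abelian_group H" "internal_direct_sum G A"
    and "\<And>i x. x \<in> A i \<Longrightarrow> \<phi> i x \<in> carrier H"
    and "\<And>i x y. \<lbrakk>x \<in> A i; y \<in> A i\<rbrakk> \<Longrightarrow> \<phi> i (x \<oplus>\<^bsub>G\<^esub> y) = \<phi> i x \<oplus>\<^bsub>H\<^esub> \<phi> i y"
  shows "\<exists>\<Phi>. abelian_group_hom G H \<Phi> \<and> (\<forall>i. \<forall>x\<in>A i. \<Phi> x = \<phi> i x)"
proof -
  interpret G: abelian_group G by fact
  interpret H: abelian_group H by fact
  let ?D = "\<lambda>x c. (\<forall>i. c i \<in> A i) \<and> finite {i. c i \<noteq> \<zero>\<^bsub>G\<^esub>} \<and>
       x = (\<Oplus>\<^bsub>G\<^esub>i\<in>{i. c i \<noteq> \<zero>\<^bsub>G\<^esub>}. c i)"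
  have A: "additive_subgroup (A i) G" for i using assms(3) by (simp add: internal_direct_sum_def)
  have sub: "A i \<subseteq> carrier G" for i using A by (rule additive_subgroup.a_subset)
  have zero: "\<zero>\<^bsub>G\<^esub> \<in> A i" for i using A by (rule additive_subgroup.zero_closed)
  have ex1: "\<exists>!c. ?D x c" if "x \<in> carrier G" for x
    using assms(3) that by (auto simp: internal_direct_sum_def)
  define c where "c x = (THE c. ?D x c)" for x
  have c: "?D x (c x)" if "x \<in> carrier G" for x unfolding c_def by (rule theI'[OF ex1[OF that]])
  \<comment> \<open>Uniqueness is restated for any finite index set containing the support: the
    support of a sum may be smaller than the union of the two supports.\<close>
  have uniq: "c x = c'" if "x \<in> carrier G" "\<forall>i. c' i \<in> A i" "finite T" "{i. c' i \<noteq> \<zero>\<^bsub>G\<^esub>} \<subseteq> T"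
    "x = (\<Oplus>\<^bsub>G\<^esub>i\<in>T. c' i)" for x c' T
  proof -
    have "(\<Oplus>\<^bsub>G\<^esub>i\<in>{i. c' i \<noteq> \<zero>\<^bsub>G\<^esub>}. c' i) = (\<Oplus>\<^bsub>G\<^esub>i\<in>T. c' i)"
      by (rule G.add.finprod_mono_neutral_cong_left) (use that sub in auto)
    then have "?D x c'" using that finite_subset by auto
    then show ?thesis using ex1[OF that(1)] c[OF that(1)] by auto
  qed
  have \<phi>0: "\<phi> i \<zero>\<^bsub>G\<^esub> = \<zero>\<^bsub>H\<^esub>" for i
    using assms(5)[OF zero zero, of i] assms(4)[OF zero, of i] by simp
  define \<Phi> where "\<Phi> x = (\<Oplus>\<^bsub>H\<^esub>i\<in>{i. c x i \<noteq> \<zero>\<^bsub>G\<^esub>}. \<phi> i (c x i))" for x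
  have \<Phi>: "\<Phi> x = (\<Oplus>\<^bsub>H\<^esub>i\<in>T. \<phi> i (c x i))"
    if "x \<in> carrier G" "finite T" "{i. c x i \<noteq> \<zero>\<^bsub>G\<^esub>} \<subseteq> T" for x T
    unfolding \<Phi>_def
    by (rule H.add.finprod_mono_neutral_cong_left) (use that c[OF that(1)] \<phi>0 assms(4) in auto)
  have "\<Phi> x \<in> carrier H" if "x \<in> carrier G" for x
    unfolding \<Phi>_def by (rule H.finsum_closed) (use c[OF that] assms(4) in auto)
  moreover have "\<Phi> (x \<oplus>\<^bsub>G\<^esub> y) = \<Phi> x \<oplus>\<^bsub>H\<^esub> \<Phi> y" if xy: "x \<in> carrier G" "y \<in> carrier G" for x y
  proof -
    let ?T = "{i. c x i \<noteq> \<zero>\<^bsub>G\<^esub>} \<union> {i. c y i \<noteq> \<zero>\<^bsub>G\<^esub>}"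
    have T: "finite ?T" using c[OF xy(1)] c[OF xy(2)] by auto
    have mem: "c x i \<in> A i" "c y i \<in> A i" for i using c[OF xy(1)] c[OF xy(2)] by auto
    have mem2: "c x i \<oplus>\<^bsub>G\<^esub> c y i \<in> A i" for i by (rule additive_subgroup.a_closed[OF A mem])
    have mem': "c x i \<in> carrier G" "c y i \<in> carrier G" for i using mem sub by auto
    have "x = (\<Oplus>\<^bsub>G\<^esub>i\<in>?T. c x i)"
      by (subst c[OF xy(1), THEN conjunct2, THEN conjunct2], rule G.add.finprod_mono_neutral_cong_left)
        (use T mem' in auto)
    moreover have "y = (\<Oplus>\<^bsub>G\<^esub>i\<in>?T. c y i)"
      by (subst c[OF xy(2), THEN conjunct2, THEN conjunct2], rule G.add.finprod_mono_neutral_cong_left)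
        (use T mem' in auto)
    ultimately have "x \<oplus>\<^bsub>G\<^esub> y = (\<Oplus>\<^bsub>G\<^esub>i\<in>?T. c x i \<oplus>\<^bsub>G\<^esub> c y i)"
      using G.finsum_addf[of "c x" ?T "c y"] mem' by auto
    then have cxy: "c (x \<oplus>\<^bsub>G\<^esub> y) = (\<lambda>i. c x i \<oplus>\<^bsub>G\<^esub> c y i)"
      by (intro uniq[OF G.a_closed[OF xy] _ T]) (use mem2 in auto)
    have "\<Phi> (x \<oplus>\<^bsub>G\<^esub> y) = (\<Oplus>\<^bsub>H\<^esub>i\<in>?T. \<phi> i (c x i \<oplus>\<^bsub>G\<^esub> c y i))"
      by (subst \<Phi>[OF _ T]) (use xy in \<open>auto simp: cxy\<close>)
    also have "\<dots> = (\<Oplus>\<^bsub>H\<^esub>i\<in>?T. \<phi> i (c x i) \<oplus>\<^bsub>H\<^esub> \<phi> i (c y i))"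
      by (simp only: assms(5)[OF mem])
    also have "\<dots> = \<Phi> x \<oplus>\<^bsub>H\<^esub> \<Phi> y"
      by (subst (1 2) \<Phi>[OF _ T]) (use xy assms(4)[OF mem(1)] assms(4)[OF mem(2)] in \<open>auto simp: H.finsum_addf\<close>)
    finally show ?thesis .
  qed
  ultimately have "abelian_group_hom G H \<Phi>"
    by (intro abelian_group_homI group_hom.intro group_hom_axioms.intro homI)
      (auto simp: assms(1,2) G.a_group H.a_group)
  moreover have "\<Phi> x = \<phi> i x" if x: "x \<in> A i" for i x
  proof -
    have xG: "x \<in> carrier G" using x sub by auto
    have cx: "c x = (\<lambda>j. if j = i then x else \<zero>\<^bsub>G\<^esub>)"
      by (rule uniq[of _ _ "{i}"]) (use x xG zero in \<open>auto simp: G.finsum_insert\<close>)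
    show ?thesis
      by (subst \<Phi>[OF xG, of "{i}"]) (use x in \<open>auto simp: cx H.finsum_insert assms(4)\<close>)
  qed
  ultimately show ?thesis by blast
qed

section \<open>Homomorphisms filtered by degree\<close>

lemma abelian_group_hom_comp:
  assumes "abelian_group_hom A B u" "abelian_group_hom B C v"
  shows "abelian_group_hom A C (\<lambda>x. v (u x))"
proof -
  interpret u: abelian_group_hom A B u by fact
  interpret v: abelian_group_hom B C v by fact
  show ?thesis
    by (intro abelian_group_homI group_hom.intro group_hom_axioms.intro homI)
      (auto simp: u.G.abelian_group_axioms v.H.abelian_group_axioms u.G.a_group v.H.a_group)
qed

lemma rmod_hom_abelian_group_hom:
  assumes "f \<in> rmod_hom R M N" "right_module R M" "right_module R N"
  shows "abelian_group_hom M N f"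
proof -
  interpret M: right_module R M by fact
  interpret N: right_module R N by fact
  show ?thesis
    by (intro abelian_group_homI group_hom.intro group_hom_axioms.intro homI)
      (use rmod_homD[OF assms(1)] in \<open>auto simp: M.M.abelian_group_axioms N.M.abelian_group_axioms
        M.M.a_group N.M.a_group\<close>)
qed

lemma rmod_hom_zero_map: "right_module R N \<Longrightarrow> (\<lambda>x. \<zero>\<^bsub>N\<^esub>) \<in> rmod_hom R M N"
proof -
  assume "right_module R N"
  then interpret right_module R N .
  show ?thesis by (auto simp: rmod_hom_def rsmult_zero_left)
qed

lemma rmod_hom_add:
  assumes "right_module R N" "f \<in> rmod_hom R M N" "g \<in> rmod_hom R M N"
  shows "(\<lambda>x. f x \<oplus>\<^bsub>N\<^esub> g x) \<in> rmod_hom R M N"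
proof -
  interpret right_module R N by fact
  note f = rmod_homD[OF assms(2)] and g = rmod_homD[OF assms(3)]
  show ?thesis
    by (auto simp: rmod_hom_def f g rsmult_add_left M.a_ac)
qed

lemma (in right_module) rsmult_minus_left:
  assumes "x \<in> carrier M" "r \<in> carrier R" shows "(\<ominus>\<^bsub>M\<^esub> x) \<cdot>\<^bsub>M\<^esub> r = \<ominus>\<^bsub>M\<^esub> (x \<cdot>\<^bsub>M\<^esub> r)"
proof -
  have "(\<ominus>\<^bsub>M\<^esub> x) \<cdot>\<^bsub>M\<^esub> r \<oplus>\<^bsub>M\<^esub> x \<cdot>\<^bsub>M\<^esub> r = \<zero>\<^bsub>M\<^esub>"
    using rsmult_add_left[of "\<ominus>\<^bsub>M\<^esub> x" x r] assms by (simp add: M.l_neg rsmult_zero_left)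
  then show ?thesis using assms by (intro M.minus_equality[symmetric]) (auto intro: rsmult_closed)
qed

lemma rmod_hom_uminus:
  assumes "right_module R N" "f \<in> rmod_hom R M N"
  shows "(\<lambda>x. \<ominus>\<^bsub>N\<^esub> f x) \<in> rmod_hom R M N"
proof -
  interpret right_module R N by fact
  note f = rmod_homD[OF assms(2)]
  show ?thesis
    by (auto simp: rmod_hom_def f rsmult_minus_left M.minus_add)
qed

lemma rmod_hom_minus:
  assumes "right_module R N" "f \<in> rmod_hom R M N" "g \<in> rmod_hom R M N"
  shows "(\<lambda>x. f x \<ominus>\<^bsub>N\<^esub> g x) \<in> rmod_hom R M N"
proof -
  interpret right_module R N by fact
  show ?thesis unfolding a_minus_def
    by (rule rmod_hom_add[OF assms(1,2) rmod_hom_uminus[OF assms(1,3)]])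
qed

lemma right_module_submodule:
  assumes "right_module R N" "rsubmodule R N S"
  shows "right_module R (N\<lparr>carrier := S\<rparr>)"
proof -
  interpret right_module R N by fact
  interpret S: additive_subgroup S N using assms(2) by (simp add: rsubmodule_def)
  have sub: "x \<in> S \<Longrightarrow> x \<in> carrier N" for x using S.a_subset by blast
  have "abelian_group (N\<lparr>carrier := S\<rparr>)"
  proof (rule abelian_groupI)
    fix x assume "x \<in> carrier (N\<lparr>carrier := S\<rparr>)"
    then show "\<exists>y\<in>carrier (N\<lparr>carrier := S\<rparr>). y \<oplus>\<^bsub>N\<lparr>carrier := S\<rparr>\<^esub> x = \<zero>\<^bsub>N\<lparr>carrier := S\<rparr>\<^esub>"
      by (intro bexI[of _ "\<ominus>\<^bsub>N\<^esub> x"])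
        (auto simp: sub M.l_neg M.abelian_group_axioms)
  qed (auto simp: sub M.a_ac)
  then show ?thesis
    by (intro right_module.intro right_module_axioms.intro R.ring_axioms)
      (use assms(2) in \<open>auto simp: sub rsubmodule_def rsmult_add_left rsmult_add_right rsmult_assoc rsmult_one\<close>)
qed

lemma rsubmodule_image:
  assumes "right_module R M" "right_module R N" "g \<in> rmod_hom R M N"
  shows "rsubmodule R N (g ` carrier M)"
proof -
  interpret M: right_module R M by fact
  interpret N: right_module R N by fact
  interpret g: abelian_group_hom M N g by (rule rmod_hom_abelian_group_hom[OF assms(3,1,2)])
  show ?thesis unfolding rsubmodule_def
  proof (intro conjI ballI additive_subgroupI')
    show "\<zero>\<^bsub>N\<^esub> \<in> g ` carrier M" by (rule image_eqI[of _ _ "\<zero>\<^bsub>M\<^esub>"]) auto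
  next
    fix x y assume "x \<in> g ` carrier M" "y \<in> g ` carrier M"
    then show "x \<oplus>\<^bsub>N\<^esub> y \<in> g ` carrier M" by (auto simp flip: g.hom_add)
  next
    fix x assume "x \<in> g ` carrier M"
    then show "\<ominus>\<^bsub>N\<^esub> x \<in> g ` carrier M" by (auto simp flip: g.hom_a_inv)
  next
    fix x r assume "x \<in> g ` carrier M" "r \<in> carrier R"
    then show "x \<cdot>\<^bsub>N\<^esub> r \<in> g ` carrier M"
      by (auto simp flip: rmod_homD(3)[OF assms(3)] intro!: M.rsmult_closed imageI)
  qed (auto simp: N.M.abelian_group_axioms)
qed

text \<open>Restricting the target to the image of \<open>g\<close> makes \<open>g\<close>
  surjective, so \<open>rprojective_lift\<close> applies. In this form the lifting property combines
  with the exactness of a resolution.\<close>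

lemma rprojective_lift_range:
  assumes P: "rprojective R P" and N: "right_module R N" "right_module R N'"
    and g: "g \<in> rmod_hom R N N'" and f: "f \<in> rmod_hom R P N'"
    and fg: "f ` carrier P \<subseteq> g ` carrier N"
  shows "\<exists>h\<in>rmod_hom R P N. \<forall>x\<in>carrier P. g (h x) = f x"
proof (rule rprojective_lift[OF P N(1)])
  let ?N = "N'\<lparr>carrier := g ` carrier N\<rparr>"
  show "right_module R ?N" by (rule right_module_submodule[OF N(2) rsubmodule_image[OF N g]])
  show "g \<in> rmod_hom R N ?N" using g by (auto simp: rmod_hom_def)
  show "f \<in> rmod_hom R P ?N" using f fg by (auto simp: rmod_hom_def)
qed auto

section \<open>Degree tails, filtered homomorphisms and truncation\<close>

definition gtail :: "('a, 'b, 'm) grmodule_scheme \<Rightarrow> int \<Rightarrow> 'b set"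
  where "gtail N t = component_sum N (gcomp N) {t..}"

text \<open>Values may spread over all degrees from \<open>j + k\<close> upwards, so maps with the
  same bound are closed under addition, even when they are sums of homogeneous maps of different
  degrees.\<close>

definition hom_degree_ge ::
  "('a, 'b, 'm) grmodule_scheme \<Rightarrow> ('a, 'c, 'n) grmodule_scheme \<Rightarrow> int \<Rightarrow> ('b \<Rightarrow> 'c) \<Rightarrow> bool"
  where "hom_degree_ge M N j f \<longleftrightarrow> (\<forall>k. f ` gcomp M k \<subseteq> gtail N (j + k))"

lemma graded_moduleD:
  assumes "graded_module R N"
  shows "right_module R N" "abelian_group N" "internal_direct_sum N (gcomp N)"
    "additive_subgroup (gcomp N i) N" "x \<in> gcomp N i \<Longrightarrow> x \<in> carrier N"
    "\<lbrakk>x \<in> gcomp N i; r \<in> hcomp R j\<rbrakk> \<Longrightarrow> x \<cdot>\<^bsub>N\<^esub> r \<in> gcomp N (i + int j)"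
proof -
  show 1: "right_module R N" "internal_direct_sum N (gcomp N)"
    "\<lbrakk>x \<in> gcomp N i; r \<in> hcomp R j\<rbrakk> \<Longrightarrow> x \<cdot>\<^bsub>N\<^esub> r \<in> gcomp N (i + int j)"
    using assms by (auto simp: graded_module_def)
  show "abelian_group N" using 1(1) by (simp add: right_module_def)
  show 2: "additive_subgroup (gcomp N i) N" using 1(2) by (simp add: internal_direct_sum_def)
  show "x \<in> gcomp N i \<Longrightarrow> x \<in> carrier N" using additive_subgroup.a_subset[OF 2] by auto
qed

lemma gtail_subgroup: "graded_module R N \<Longrightarrow> additive_subgroup (gtail N t) N"
  unfolding gtail_def
  by (rule additive_subgroup_component_sum) (auto intro: graded_moduleD)

lemma gcomp_subset_gtail:
  assumes "graded_module R N" "t \<le> i" shows "gcomp N i \<subseteq> gtail N t"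
  unfolding gtail_def
  by (rule component_subset_component_sum)
    (use assms in \<open>auto intro: graded_moduleD(2,5)\<close>)

lemma gtail_subset:
  assumes "graded_module R N" "additive_subgroup S N" "\<And>i. t \<le> i \<Longrightarrow> gcomp N i \<subseteq> S"
  shows "gtail N t \<subseteq> S"
  unfolding gtail_def
  by (rule component_sum_subset) (use assms in \<open>auto intro: graded_moduleD(2)\<close>)

lemma gtail_antimono: "\<lbrakk>graded_module R N; s \<le> t\<rbrakk> \<Longrightarrow> gtail N t \<subseteq> gtail N s"
  by (rule gtail_subset[OF _ gtail_subgroup]) (simp_all add: gcomp_subset_gtail)

text \<open>The elements mapped into the target tail form an additive subgroup, and this subgroup
  contains each component of degree at least \<open>t\<close> because tails shrink as the degree
  grows.\<close>

lemma hom_degree_ge_gtail: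
  assumes "graded_module R M" "graded_module R N" "f \<in> rmod_hom R M N" "hom_degree_ge M N j f"
    and x: "x \<in> gtail M t"
  shows "f x \<in> gtail N (j + t)"
proof -
  have h: "abelian_group_hom M N f"
    by (rule rmod_hom_abelian_group_hom[OF assms(3)]) (use assms graded_moduleD in blast)+
  have "gtail M t \<subseteq> {x \<in> carrier M. f x \<in> gtail N (j + t)}"
  proof (rule gtail_subset[OF assms(1) additive_subgroup_vimage[OF h gtail_subgroup[OF assms(2)]]], rule subsetI)
    fix i x assume "t \<le> i" "x \<in> gcomp M i"
    then have "f x \<in> gtail N (j + i)" using assms(4) by (auto simp: hom_degree_ge_def)
    also have "\<dots> \<subseteq> gtail N (j + t)" using \<open>t \<le> i\<close> by (intro gtail_antimono[OF assms(2)]) auto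
    finally show "x \<in> {x \<in> carrier M. f x \<in> gtail N (j + t)}"
      using \<open>x \<in> gcomp M i\<close> graded_moduleD(5)[OF assms(1)] by auto
  qed
  then show ?thesis using x by auto
qed

lemma hom_degree_ge_comp:
  assumes "graded_module R M" "graded_module R N" "g \<in> rmod_hom R M N"
    and "hom_degree_ge L M i f" "hom_degree_ge M N j g"
  shows "hom_degree_ge L N (i + j) (\<lambda>x. g (f x))"
  unfolding hom_degree_ge_def
proof (intro allI subsetI, elim imageE, hypsubst)
  fix k x assume "x \<in> gcomp L k"
  then have "f x \<in> gtail M (i + k)" using assms(4) by (auto simp: hom_degree_ge_def)
  from hom_degree_ge_gtail[OF assms(1-3,5) this]
  show "g (f x) \<in> gtail N (i + j + k)" by (simp add: algebra_simps)
qed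

lemma hom_degree_imp_ge:
  assumes "graded_module R N" "hom_degree M N i f" "j \<le> i"
  shows "hom_degree_ge M N j f"
  unfolding hom_degree_ge_def
proof (intro allI)
  fix k
  have "f ` gcomp M k \<subseteq> gcomp N (i + k)" using assms(2) by (auto simp: hom_degree_def)
  also have "\<dots> \<subseteq> gtail N (j + k)" by (rule gcomp_subset_gtail) (use assms in auto)
  finally show "f ` gcomp M k \<subseteq> gtail N (j + k)" .
qed

text \<open>The projection onto degrees at least \<open>t\<close>. In general it is only additive:
  multiplication by an element of positive degree can carry a component across the cut-off.\<close>

lemma ex_truncation:
  assumes "graded_module R N"
  shows "\<exists>\<tau>. abelian_group_hom N N \<tau> \<and>
    (\<forall>i. \<forall>x\<in>gcomp N i. \<tau> x = (if t \<le> i then x else \<zero>\<^bsub>N\<^esub>))"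
proof -
  interpret abelian_group N by (rule graded_moduleD(2)[OF assms])
  show ?thesis
    by (rule internal_direct_sum_extend)
      (use graded_moduleD[OF assms] in \<open>auto simp: abelian_group_axioms\<close>)
qed

text \<open>An ungraded lift \<open>h\<close> is corrected by cutting off, on each component \<open>P\<^sub>k\<close>, the part of its value
  in degrees below \<open>j + k\<close>; this remains linear because elements of \<open>R\<^sub>s\<close> shift both cut-offs by \<open>s\<close>.\<close>

lemma graded_lift:
  assumes R: "graded_algebra K R" and P: "graded_module R P" "rprojective R P"
    and N: "graded_module R N" "graded_module R N'"
    and g: "g \<in> rmod_hom R N N'" "hom_degree N N' 0 g"
    and f: "f \<in> rmod_hom R P N'" "hom_degree_ge P N' j f"
    and fg: "f ` carrier P \<subseteq> g ` carrier N"
  shows "\<exists>h\<in>rmod_hom R P N. hom_degree_ge P N j h \<and> (\<forall>x\<in>carrier P. g (h x) = f x)"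
proof -
  note PD = graded_moduleD[OF P(1)] and ND = graded_moduleD[OF N(1)] and N'D = graded_moduleD[OF N(2)]
  interpret P: right_module R P by (rule PD)
  interpret N: right_module R N by (rule ND)
  interpret N': right_module R N' by (rule N'D)
  have Rds: "internal_direct_sum R (hcomp R)" using R by (simp add: graded_algebra_def)
  have Rsub: "hcomp R s \<subseteq> carrier R" for s
    using Rds by (auto simp: internal_direct_sum_def dest: additive_subgroup.a_subset)
  obtain h where h: "h \<in> rmod_hom R P N" "\<And>x. x \<in> carrier P \<Longrightarrow> g (h x) = f x"
    using rprojective_lift_range[OF P(2) ND(1) N'D(1) g(1) f(1) fg] by blast
  obtain \<tau> where \<tau>: "\<And>t. abelian_group_hom N N (\<tau> t)"
    "\<And>t i x. x \<in> gcomp N i \<Longrightarrow> \<tau> t x = (if t \<le> i then x else \<zero>\<^bsub>N\<^esub>)"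
    using ex_truncation[OF N(1)] by metis
  obtain \<tau>' where \<tau>': "\<And>t. abelian_group_hom N' N' (\<tau>' t)"
    "\<And>t i x. x \<in> gcomp N' i \<Longrightarrow> \<tau>' t x = (if t \<le> i then x else \<zero>\<^bsub>N'\<^esub>)"
    using ex_truncation[OF N(2)] by metis
  note rhom = rmod_hom_abelian_group_hom
  have hP: "h x \<in> carrier N" if "x \<in> carrier P" for x using rmod_homD(1)[OF h(1) that] .
  have \<tau>c: "\<tau> t y \<in> carrier N" if "y \<in> carrier N" for t y
    using abelian_group_hom.hom_closed[OF \<tau>(1) that] .
  note comp = abelian_group_hom_comp
  have \<tau>_tail: "\<tau> t y \<in> gtail N t" if "y \<in> carrier N" for t y
  proof -
    have "carrier N \<subseteq> {y \<in> carrier N. \<tau> t y \<in> gtail N t}"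
      by (rule internal_direct_sum_subset[OF ND(2,3) additive_subgroup_vimage[OF \<tau>(1) gtail_subgroup[OF N(1)]]])
        (use ND(5) subsetD[OF gcomp_subset_gtail[OF N(1)]] additive_subgroup.zero_closed[OF gtail_subgroup[OF N(1)]] in \<open>auto simp: \<tau>(2)\<close>)
    then show ?thesis using that by auto
  qed
  \<comment> \<open>Since \<open>g\<close> has degree 0, it commutes with cutting off at the same
    degree on both sides.\<close>
  have \<tau>g: "g (\<tau> t y) = \<tau>' t (g y)" if "y \<in> carrier N" for t y
  proof -
    note gh = rhom[OF g(1) ND(1) N'D(1)]
    have "carrier N \<subseteq> {y \<in> carrier N. g (\<tau> t y) = \<tau>' t (g y)}"
    proof (rule internal_direct_sum_subset[OF ND(2,3) additive_subgroup_eq[OF comp[OF \<tau>(1) gh] comp[OF gh \<tau>'(1)]]], rule subsetI)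
      fix i y assume y: "y \<in> gcomp N i"
      then have "g y \<in> gcomp N' i" using g(2) by (auto simp: hom_degree_def)
      then show "y \<in> {y \<in> carrier N. g (\<tau> t y) = \<tau>' t (g y)}"
        using y ND(5) \<tau>(2)[OF y] \<tau>'(2) abelian_group_hom.hom_zero[OF gh] by auto
    qed
    then show ?thesis using that by auto
  qed
  have \<tau>'_tail: "\<tau>' t y = y" if "y \<in> gtail N' t" for t y
  proof -
    have "gtail N' t \<subseteq> {y \<in> carrier N'. \<tau>' t y = (\<lambda>x. x) y}"
      by (rule gtail_subset[OF N(2) additive_subgroup_eq[OF \<tau>'(1)]])
        (use N'D(5) \<tau>'(2) in \<open>auto intro!: abelian_group_homI group_hom.intro group_hom_axioms.intro homI
           simp: N'.M.abelian_group_axioms N'.M.a_group\<close>)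
    then show ?thesis using that by auto
  qed
  have \<tau>r: "\<tau> (t + int s) (y \<cdot>\<^bsub>N\<^esub> r) = \<tau> t y \<cdot>\<^bsub>N\<^esub> r" if "y \<in> carrier N" "r \<in> hcomp R s" for t y r s
  proof -
    have r: "r \<in> carrier R" using Rsub that(2) by auto
    have rh: "abelian_group_hom N N (\<lambda>y. y \<cdot>\<^bsub>N\<^esub> r)"
      by (intro abelian_group_homI group_hom.intro group_hom_axioms.intro homI)
        (auto simp: N.M.abelian_group_axioms N.M.a_group r N.rsmult_closed N.rsmult_add_left)
    have "carrier N \<subseteq> {y \<in> carrier N. \<tau> (t + int s) (y \<cdot>\<^bsub>N\<^esub> r) = \<tau> t y \<cdot>\<^bsub>N\<^esub> r}"
    proof (rule internal_direct_sum_subset[OF ND(2,3) additive_subgroup_eq[OF comp[OF rh \<tau>(1)] comp[OF \<tau>(1) rh]]], rule subsetI)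
      fix i y assume y: "y \<in> gcomp N i"
      then show "y \<in> {y \<in> carrier N. \<tau> (t + int s) (y \<cdot>\<^bsub>N\<^esub> r) = \<tau> t y \<cdot>\<^bsub>N\<^esub> r}"
        using ND(5) \<tau>(2)[OF y] \<tau>(2)[OF ND(6)[OF y that(2)]] N.rsmult_zero_left[OF r] by auto
    qed
    then show ?thesis using that by auto
  qed
  \<comment> \<open>The cut-off depends on the degree of the argument, so the corrected lift is
    glued from the components of \<open>P\<close>. This gives an additive map, whose linearity is
    proved next.\<close>
  obtain h' where h': "abelian_group_hom P N h'"
    "\<And>k x. x \<in> gcomp P k \<Longrightarrow> h' x = \<tau> (j + k) (h x)"
  proof -
    have "\<exists>\<Phi>. abelian_group_hom P N \<Phi> \<and> (\<forall>k. \<forall>x\<in>gcomp P k. \<Phi> x = \<tau> (j + k) (h x))"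
      by (rule internal_direct_sum_extend[OF PD(2) ND(2) PD(3)])
        (use PD(5) hP \<tau>c rmod_homD(2)[OF h(1)] abelian_group_hom.hom_add[OF \<tau>(1)] in auto)
    then show ?thesis using that by blast
  qed
  interpret h': abelian_group_hom P N h' by (rule h'(1))
  have lin: "h' (x \<cdot>\<^bsub>P\<^esub> r) = h' x \<cdot>\<^bsub>N\<^esub> r" if x: "x \<in> carrier P" and r: "r \<in> carrier R" for x r
  proof -
    \<comment> \<open>Linearity is checked for homogeneous \<open>x\<close> and \<open>r\<close>,
      then extended additively in \<open>x\<close> and finally in \<open>r\<close>.\<close>
    have 1: "h' (x \<cdot>\<^bsub>P\<^esub> r) = h' x \<cdot>\<^bsub>N\<^esub> r" if xk: "x \<in> gcomp P k" and rs: "r \<in> hcomp R s" for x k r s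
    proof -
      have r: "r \<in> carrier R" using Rsub rs by auto
      have x: "x \<in> carrier P" using PD(5) xk .
      have "h' (x \<cdot>\<^bsub>P\<^esub> r) = \<tau> (j + (k + int s)) (h (x \<cdot>\<^bsub>P\<^esub> r))" by (rule h'(2)[OF PD(6)[OF xk rs]])
      also have "\<dots> = \<tau> (j + k + int s) (h x \<cdot>\<^bsub>N\<^esub> r)"
        using rmod_homD(3)[OF h(1) x r] by (simp add: algebra_simps)
      also have "\<dots> = h' x \<cdot>\<^bsub>N\<^esub> r" using \<tau>r[OF hP[OF x] rs] h'(2)[OF xk] by simp
      finally show ?thesis .
    qed
    have 2: "h' (x \<cdot>\<^bsub>P\<^esub> r) = h' x \<cdot>\<^bsub>N\<^esub> r" if x: "x \<in> carrier P" and rs: "r \<in> hcomp R s" for x r s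
    proof -
      have r: "r \<in> carrier R" using Rsub rs by auto
      have "carrier P \<subseteq> {x \<in> carrier P. h' (x \<cdot>\<^bsub>P\<^esub> r) = h' x \<cdot>\<^bsub>N\<^esub> r}"
      proof (rule internal_direct_sum_subset[OF PD(2,3)])
        show "additive_subgroup {x \<in> carrier P. h' (x \<cdot>\<^bsub>P\<^esub> r) = h' x \<cdot>\<^bsub>N\<^esub> r} P"
          by (rule additive_subgroupI'[OF PD(2)])
            (auto simp: r P.rsmult_closed P.rsmult_add_left N.rsmult_add_left P.rsmult_minus_left
               N.rsmult_minus_left P.rsmult_zero_left N.rsmult_zero_left)
      qed (use 1[OF _ rs] PD(5) in auto)
      then show ?thesis using x by auto
    qed
    have rsub: "additive_subgroup {r \<in> carrier R. h' (x \<cdot>\<^bsub>P\<^esub> r) = h' x \<cdot>\<^bsub>N\<^esub> r} R"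
    proof (rule additive_subgroup_eq)
      show "abelian_group_hom R N (\<lambda>r. h' (x \<cdot>\<^bsub>P\<^esub> r))" "abelian_group_hom R N (\<lambda>r. h' x \<cdot>\<^bsub>N\<^esub> r)"
        by (intro abelian_group_homI group_hom.intro group_hom_axioms.intro homI;
            auto simp: x P.rsmult_closed N.rsmult_closed P.rsmult_add_right N.rsmult_add_right N.M.abelian_group_axioms N.M.a_group
              P.R.abelian_group_axioms P.R.a_group)+
    qed
    have "carrier R \<subseteq> {r \<in> carrier R. h' (x \<cdot>\<^bsub>P\<^esub> r) = h' x \<cdot>\<^bsub>N\<^esub> r}"
      by (rule internal_direct_sum_subset[OF P.R.abelian_group_axioms Rds rsub]) (use 2[OF x] Rsub in auto)
    then show ?thesis using r by auto
  qed
  have "h' \<in> rmod_hom R P N" using lin by (auto simp: rmod_hom_def)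
  moreover have "hom_degree_ge P N j h'"
    using \<tau>_tail[OF hP[OF PD(5)]] by (auto simp: hom_degree_ge_def h'(2))
  moreover have "g (h' x) = f x" if "x \<in> carrier P" for x
  proof -
    have "carrier P \<subseteq> {x \<in> carrier P. g (h' x) = f x}"
    proof (rule internal_direct_sum_subset[OF PD(2,3) additive_subgroup_eq[OF
          comp[OF h'(1) rhom[OF g(1) ND(1) N'D(1)]] rhom[OF f(1) PD(1) N'D(1)]]], rule subsetI)
      fix k x assume x: "x \<in> gcomp P k"
      \<comment> \<open>The degree bound on \<open>f\<close> enters here:
        \<open>g (h x) = f x\<close> already lies in the tail, so truncation leaves it
        unchanged.\<close>
      then have "f x \<in> gtail N' (j + k)" using f(2) by (auto simp: hom_degree_ge_def)
      then have "g (h' x) = f x"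
        using PD(5)[OF x] h(2) by (simp add: h'(2)[OF x] \<tau>g[OF hP] \<tau>'_tail)
      then show "x \<in> {x \<in> carrier P. g (h' x) = f x}" using PD(5)[OF x] by auto
    qed
    then show ?thesis using that by auto
  qed
  ultimately show ?thesis by blast
qed

section \<open>Chain maps and homotopies\<close>

text \<open>The locale covers an arbitrary graded projective resolution with finitely generated
  terms, because \<open>ext_filt_eq_zero\<close> interprets it a second time, for the linear
  resolution of \<open>M\<close>.\<close>

locale graded_resolution =
  fixes K :: "('k, 'l) ring_scheme"
    and R :: "('k, 'a, 'r) gralg_scheme"
    and M :: "('a, 'b, 'm) grmodule_scheme"
    and P :: "nat \<Rightarrow> ('a, 'p, 'q) grmodule_scheme"
    and d :: "nat \<Rightarrow> 'p \<Rightarrow> 'p"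
    and e :: "'p \<Rightarrow> 'b"
  assumes graded_algebra: "graded_algebra K R"
    and graded_module_M: "graded_module R M"
    and resolution: "graded_projective_resolution R M P d e"
begin

text \<open>The coefficients \<open>N\<close> vary: besides \<open>M\<close>, homotopies involve
  coboundaries with values in the terms \<open>P m\<close>.\<close>

abbreviation cob :: "('a, 'c, 'n) rmodule_scheme \<Rightarrow> nat \<Rightarrow> ('p \<Rightarrow> 'c) set"
  where "cob N n \<equiv> ext_coboundaries R N P d n"

abbreviation cocyc :: "nat \<Rightarrow> ('p \<Rightarrow> 'b) set"
  where "cocyc n \<equiv> ext_cocycles R M P d n"

abbreviation rel :: "nat \<Rightarrow> (('p \<Rightarrow> 'b) \<times> ('p \<Rightarrow> 'b)) set"
  where "rel n \<equiv> ext_rel R M P d n"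

abbreviation cls :: "nat \<Rightarrow> ('p \<Rightarrow> 'b) \<Rightarrow> ('p \<Rightarrow> 'b) set"
  where "cls n f \<equiv> ext_class R M P d n f"

abbreviation Ext :: "nat \<Rightarrow> ('p \<Rightarrow> 'b) set ring"
  where "Ext n \<equiv> ext_group R M P d n"

lemma term_graded: "graded_module R (P n)"
  and term_projective: "rprojective R (P n)"
  and d_hom: "d n \<in> rmod_hom R (P (Suc n)) (P n)"
  and d_degree: "hom_degree (P (Suc n)) (P n) 0 (d n)"
  and e_hom: "e \<in> rmod_hom R (P 0) M"
  and e_degree: "hom_degree (P 0) M 0 e"
  and e_surj: "e ` carrier (P 0) = carrier M"
  using resolution by (auto simp: graded_projective_resolution_def)

lemma term_module: "right_module R (P n)"
  by (rule graded_moduleD(1)[OF term_graded])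

lemma module_M: "right_module R M"
  by (rule graded_moduleD(1)[OF graded_module_M])

lemma exact_0: "x \<in> d 0 ` carrier (P (Suc 0)) \<longleftrightarrow> x \<in> carrier (P 0) \<and> e x = \<zero>\<^bsub>M\<^esub>"
  using resolution by (auto simp: graded_projective_resolution_def a_kernel_def')

lemma exact_Suc:
  "x \<in> d (Suc n) ` carrier (P (Suc (Suc n))) \<longleftrightarrow> x \<in> carrier (P (Suc n)) \<and> d n x = \<zero>\<^bsub>P n\<^esub>"
  using resolution by (auto simp: graded_projective_resolution_def a_kernel_def')

lemma d_d: "x \<in> carrier (P (Suc (Suc n))) \<Longrightarrow> d n (d (Suc n) x) = \<zero>\<^bsub>P n\<^esub>"
  using exact_Suc by blast

lemma e_d: "x \<in> carrier (P (Suc 0)) \<Longrightarrow> e (d 0 x) = \<zero>\<^bsub>M\<^esub>"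
  using exact_0 by blast

lemma rmod_hom_zero:
  assumes "f \<in> rmod_hom R N N'" "right_module R N" "right_module R N'"
  shows "f \<zero>\<^bsub>N\<^esub> = \<zero>\<^bsub>N'\<^esub>"
  by (rule abelian_group_hom.hom_zero[OF rmod_hom_abelian_group_hom[OF assms]])

text \<open>Comparison theorem with a degree bound. All differentials have degree 0, so
  \<open>graded_lift\<close> keeps the bound \<open>j\<close> at every stage. The source is a
  complex of projectives, so that both a shifted part of \<open>P\<close> and another resolution can
  be inserted.\<close>

lemma ex_chain_lift:
  fixes D :: "nat \<Rightarrow> ('a, 'c, 'n) grmodule_scheme"
  assumes D: "\<And>k. graded_module R (D k)" "\<And>k. rprojective R (D k)"
    and \<delta>: "\<And>k. \<delta> k \<in> rmod_hom R (D (Suc k)) (D k)" "\<And>k. hom_degree (D (Suc k)) (D k) 0 (\<delta> k)"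
      "\<And>k x. x \<in> carrier (D (Suc (Suc k))) \<Longrightarrow> \<delta> k (\<delta> (Suc k) x) = \<zero>\<^bsub>D k\<^esub>"
    and f: "f \<in> rmod_hom R (D 0) M" "hom_degree_ge (D 0) M j f"
      "\<And>x. x \<in> carrier (D (Suc 0)) \<Longrightarrow> f (\<delta> 0 x) = \<zero>\<^bsub>M\<^esub>"
  shows "\<exists>F. (\<forall>k. F k \<in> rmod_hom R (D k) (P k)) \<and> (\<forall>k. hom_degree_ge (D k) (P k) j (F k)) \<and>
    (\<forall>x\<in>carrier (D 0). e (F 0 x) = f x) \<and>
    (\<forall>k. \<forall>x\<in>carrier (D (Suc k)). d k (F (Suc k) x) = F k (\<delta> k x))"
proof -
  note DM = graded_moduleD(1)[OF D(1)]
  \<comment> \<open>The last conjunct is the condition for lifting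
    \<open>F \<circ> \<delta> k\<close> through \<open>d k\<close>, which is what the next component
    requires. At \<open>k = 0\<close> the lift is taken over the augmentation instead of a
    differential.\<close>
  let ?I = "\<lambda>k F. F \<in> rmod_hom R (D k) (P k) \<and> hom_degree_ge (D k) (P k) j F \<and>
    (k = 0 \<longrightarrow> (\<forall>x\<in>carrier (D 0). e (F x) = f x)) \<and>
    (\<forall>x\<in>carrier (D (Suc k)). F (\<delta> k x) \<in> d k ` carrier (P (Suc k)))"
  let ?Q = "\<lambda>k F G. \<forall>x\<in>carrier (D (Suc k)). d k (G x) = F (\<delta> k x)"
  have "\<exists>F. \<forall>k. ?I k (F k) \<and> ?Q k (F k) (F (Suc k))"
  proof (rule dependent_nat_choice)
    have "\<exists>h\<in>rmod_hom R (D 0) (P 0). hom_degree_ge (D 0) (P 0) j h \<and> (\<forall>x\<in>carrier (D 0). e (h x) = f x)"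
      by (rule graded_lift[OF graded_algebra D term_graded graded_module_M e_hom e_degree f(1,2)])
        (use rmod_homD(1)[OF f(1)] e_surj in auto)
    then obtain h where h: "h \<in> rmod_hom R (D 0) (P 0)" "hom_degree_ge (D 0) (P 0) j h"
      "\<And>x. x \<in> carrier (D 0) \<Longrightarrow> e (h x) = f x" by blast
    have "h (\<delta> 0 x) \<in> d 0 ` carrier (P (Suc 0))" if "x \<in> carrier (D (Suc 0))" for x
      using that h(3) f(3) rmod_homD(1)[OF \<delta>(1)] rmod_homD(1)[OF h(1)] by (simp add: exact_0)
    then show "\<exists>F. ?I 0 F" using h by blast
  next
    fix F k assume F: "?I k F"
    have c: "(\<lambda>x. F (\<delta> k x)) \<in> rmod_hom R (D (Suc k)) (P k)"
      using F by (intro rmod_hom_comp[OF \<delta>(1)]) auto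
    have "hom_degree_ge (D (Suc k)) (P k) (0 + j) (\<lambda>x. F (\<delta> k x))"
      by (rule hom_degree_ge_comp[OF D(1) term_graded _ hom_degree_imp_ge[OF D(1) \<delta>(2)]]) (use F in auto)
    then have "\<exists>h\<in>rmod_hom R (D (Suc k)) (P (Suc k)). hom_degree_ge (D (Suc k)) (P (Suc k)) j h \<and>
        (\<forall>x\<in>carrier (D (Suc k)). d k (h x) = F (\<delta> k x))"
      by (intro graded_lift[OF graded_algebra D term_graded term_graded d_hom d_degree c]) (use F in auto)
    then obtain h where h: "h \<in> rmod_hom R (D (Suc k)) (P (Suc k))"
      "hom_degree_ge (D (Suc k)) (P (Suc k)) j h"
      "\<And>x. x \<in> carrier (D (Suc k)) \<Longrightarrow> d k (h x) = F (\<delta> k x)" by blast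
    \<comment> \<open>The image is a cycle because
      \<open>\<delta> k \<circ> \<delta> (Suc k)\<close> vanishes; exactness of \<open>P\<close>
      makes it a boundary.\<close>
    have "h (\<delta> (Suc k) x) \<in> d (Suc k) ` carrier (P (Suc (Suc k)))" if x: "x \<in> carrier (D (Suc (Suc k)))" for x
    proof -
      have "\<delta> (Suc k) x \<in> carrier (D (Suc k))" by (rule rmod_homD(1)[OF \<delta>(1) x])
      moreover from this have "d k (h (\<delta> (Suc k) x)) = \<zero>\<^bsub>P k\<^esub>"
        using h(3) \<delta>(3)[OF x] rmod_hom_zero[OF _ DM term_module, of F] F by simp
      ultimately show ?thesis using rmod_homD(1)[OF h(1)] by (simp add: exact_Suc)
    qed
    then show "\<exists>G. ?I (Suc k) G \<and> ?Q k F G" using h by blast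
  qed
  then obtain F where F: "\<And>k. ?I k (F k)" "\<And>k. ?Q k (F k) (F (Suc k))" by metis
  show ?thesis
    by (intro exI[of _ F] conjI allI) (simp_all add: F(1)[THEN conjunct1] F(1)[THEN conjunct2, THEN conjunct1] F(2) F(1)[of 0, simplified])
qed

section \<open>Coboundaries with varying coefficients\<close>

lemma cob_SucI: "h \<in> rmod_hom R (P m) N \<Longrightarrow> (\<lambda>x. h (d m x)) \<in> cob N (Suc m)"
  by (auto simp: ext_coboundaries_def)

lemma cob_cases:
  assumes "b \<in> cob N n"
  obtains (zero) "n = 0" "b = (\<lambda>x. \<zero>\<^bsub>N\<^esub>)"
  | (Suc) m h where "n = Suc m" "h \<in> rmod_hom R (P m) N" "b = (\<lambda>x. h (d m x))"
  using assms by (cases n) (auto simp: ext_coboundaries_def)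

lemma cob_zero:
  assumes "right_module R N" shows "(\<lambda>x. \<zero>\<^bsub>N\<^esub>) \<in> cob N n"
proof (cases n)
  case 0
  then show ?thesis by (simp add: ext_coboundaries_def)
next
  case (Suc m)
  then show ?thesis using cob_SucI[OF rmod_hom_zero_map[OF assms], of m] by simp
qed

lemma cob_add:
  assumes N: "right_module R N" and b: "b \<in> cob N n" and c: "c \<in> cob N n"
  shows "(\<lambda>x. b x \<oplus>\<^bsub>N\<^esub> c x) \<in> cob N n"
proof -
  interpret right_module R N by fact
  show ?thesis using b
  proof (cases rule: cob_cases)
    case zero
    with c show ?thesis by (simp add: ext_coboundaries_def)
  next
    case (Suc m h)
    from c obtain h' where h': "h' \<in> rmod_hom R (P m) N" "c = (\<lambda>x. h' (d m x))"
      by (cases rule: cob_cases) (use Suc(1) in auto)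
    show ?thesis unfolding Suc(1,3) h'(2) by (rule cob_SucI[OF rmod_hom_add[OF N Suc(2) h'(1)]])
  qed
qed

lemma cob_uminus:
  assumes N: "right_module R N" and b: "b \<in> cob N n"
  shows "(\<lambda>x. \<ominus>\<^bsub>N\<^esub> b x) \<in> cob N n"
proof -
  interpret right_module R N by fact
  show ?thesis using b
  proof (cases rule: cob_cases)
    case zero
    then show ?thesis by (simp add: ext_coboundaries_def M.minus_equality[of "\<zero>\<^bsub>N\<^esub>" "\<zero>\<^bsub>N\<^esub>"])
  next
    case (Suc m h)
    show ?thesis unfolding Suc(1,3) by (rule cob_SucI[OF rmod_hom_uminus[OF N Suc(2)]])
  qed
qed

lemma cob_hom:
  assumes "right_module R N" "b \<in> cob N n" shows "b \<in> rmod_hom R (P n) N"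
  using assms(2)
proof (cases rule: cob_cases)
  case zero
  then show ?thesis using rmod_hom_zero_map[OF assms(1)] by simp
next
  case (Suc m h)
  show ?thesis unfolding Suc(1,3) by (rule rmod_hom_comp[OF d_hom Suc(2)])
qed

lemma cob_d:
  assumes N: "right_module R N" and b: "b \<in> cob N n" and x: "x \<in> carrier (P (Suc n))"
  shows "b (d n x) = \<zero>\<^bsub>N\<^esub>"
  using b
proof (cases rule: cob_cases)
  case (Suc m h)
  show ?thesis
    using d_d[of x m] x rmod_hom_zero[OF Suc(2) term_module N] unfolding Suc(1,3) by simp
qed simp

lemma cob_comp:
  assumes N: "right_module R N" "right_module R N'" and g: "g \<in> rmod_hom R N N'" and b: "b \<in> cob N n"
  shows "(\<lambda>x. g (b x)) \<in> cob N' n"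
  using b
proof (cases rule: cob_cases)
  case zero
  then show ?thesis using rmod_hom_zero[OF g N] cob_zero[OF N(2), of 0] by simp
next
  case (Suc m h)
  show ?thesis unfolding Suc(1,3) by (rule cob_SucI[OF rmod_hom_comp[OF Suc(2) g]])
qed

text \<open>Above degree 0 a coboundary is \<open>h \<circ> d m\<close> with \<open>h\<close>
  defined on the projective term \<open>P m\<close>, and it suffices to lift
  \<open>h\<close>.\<close>

lemma cob_lift:
  assumes "right_module R N" "right_module R N'" "g \<in> rmod_hom R N N'" "g ` carrier N = carrier N'"
    and "b \<in> cob N' n"
  shows "\<exists>c\<in>cob N n. \<forall>x\<in>carrier (P n). g (c x) = b x"
  using assms(5)
proof (cases rule: cob_cases)
  case zero
  show ?thesis
    by (rule bexI[OF _ cob_zero[OF assms(1)]]) (simp add: zero rmod_hom_zero[OF assms(3,1,2)])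
next
  case (Suc m h)
  obtain h' where h': "h' \<in> rmod_hom R (P m) N" "\<And>x. x \<in> carrier (P m) \<Longrightarrow> g (h' x) = h x"
    using rprojective_lift[OF term_projective assms(1-4) Suc(2)] by blast
  show ?thesis unfolding Suc(1,3)
    by (rule bexI[OF _ cob_SucI[OF h'(1)]]) (simp add: h'(2) rmod_homD(1)[OF d_hom])
qed

text \<open>Exactness identifies the kernel of \<open>d n\<close> with the image of the next
  differential, so projectivity of the source gives the lift.\<close>

lemma lift_kernel_d:
  assumes "rprojective R X" "u \<in> rmod_hom R X (P (Suc n))" "\<And>x. x \<in> carrier X \<Longrightarrow> d n (u x) = \<zero>\<^bsub>P n\<^esub>"
  shows "\<exists>s\<in>rmod_hom R X (P (Suc (Suc n))). \<forall>x\<in>carrier X. d (Suc n) (s x) = u x"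
  by (rule rprojective_lift_range[OF assms(1) term_module term_module d_hom assms(2)])
    (use assms(3) rmod_homD(1)[OF assms(2)] in \<open>auto simp: exact_Suc\<close>)

lemma lift_kernel_e:
  assumes "rprojective R X" "u \<in> rmod_hom R X (P 0)" "\<And>x. x \<in> carrier X \<Longrightarrow> e (u x) = \<zero>\<^bsub>M\<^esub>"
  shows "\<exists>s\<in>rmod_hom R X (P (Suc 0)). \<forall>x\<in>carrier X. d 0 (s x) = u x"
  by (rule rprojective_lift_range[OF assms(1) term_module term_module d_hom assms(2)])
    (use assms(3) rmod_homD(1)[OF assms(2)] in \<open>auto simp: exact_0\<close>)

text \<open>The term \<open>t\<close> is \<open>s\<^sub>m\<^sub>-\<^sub>1 \<circ> d\<close> in the usual notation for a homotopy \<open>s\<close>. Stating it as membership in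
  the coboundaries with values in \<open>P m\<close> covers the case \<open>n = m = 0\<close>, where there is no such map.\<close>

lemma chain_map_homotopy:
  assumes F: "\<And>k. F k \<in> rmod_hom R (P (n + k)) (P k)"
      "\<And>k x. x \<in> carrier (P (n + Suc k)) \<Longrightarrow> d k (F (Suc k) x) = F k (d (n + k) x)"
    and b: "b \<in> cob M n" "\<And>x. x \<in> carrier (P n) \<Longrightarrow> e (F 0 x) = b x"
  shows "\<exists>s\<in>rmod_hom R (P (n + m)) (P (Suc m)). \<exists>t\<in>cob (P m) (n + m).
    \<forall>x\<in>carrier (P (n + m)). F m x = d m (s x) \<oplus>\<^bsub>P m\<^esub> t x"
proof (induction m)
  case 0
  interpret P0: right_module R "P 0" by (rule term_module)
  interpret e: abelian_group_hom "P 0" M e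
    by (rule rmod_hom_abelian_group_hom[OF e_hom term_module module_M])
  \<comment> \<open>The coboundary \<open>b\<close> is first lifted along \<open>e\<close> to the
    coefficients \<open>P 0\<close>; subtracting the lift moves \<open>F 0\<close> into the kernel
    of \<open>e\<close>.\<close>
  obtain t where t: "t \<in> cob (P 0) n" "\<And>x. x \<in> carrier (P n) \<Longrightarrow> e (t x) = b x"
    using cob_lift[OF term_module module_M e_hom e_surj b(1)] by blast
  note t_hom = cob_hom[OF term_module t(1)]
  have F0: "F 0 \<in> rmod_hom R (P n) (P 0)" using F(1)[of 0] by simp
  note cl = rmod_homD(1)[OF F0] rmod_homD(1)[OF t_hom]
  have "e (F 0 x \<ominus>\<^bsub>P 0\<^esub> t x) = \<zero>\<^bsub>M\<^esub>" if "x \<in> carrier (P n)" for x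
    using that cl b(2) t(2) e.hom_closed[OF cl(2)[OF that]] by (simp add: a_minus_def e.H.r_neg)
  from lift_kernel_e[OF term_projective rmod_hom_minus[OF term_module F0 t_hom] this]
  obtain s where s: "s \<in> rmod_hom R (P n) (P (Suc 0))"
    "\<And>x. x \<in> carrier (P n) \<Longrightarrow> d 0 (s x) = F 0 x \<ominus>\<^bsub>P 0\<^esub> t x" by blast
  have "F 0 x = d 0 (s x) \<oplus>\<^bsub>P 0\<^esub> t x" if "x \<in> carrier (P n)" for x
    using that cl by (simp add: s(2) a_minus_def P0.M.a_assoc P0.M.l_neg)
  then show ?case using s(1) t(1) by auto
next
  case (Suc m)
  interpret Pm: right_module R "P m" by (rule term_module)
  interpret Pm': right_module R "P (Suc m)" by (rule term_module)
  interpret d: abelian_group_hom "P (Suc m)" "P m" "d m"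
    by (rule rmod_hom_abelian_group_hom[OF d_hom term_module term_module])
  obtain s t where s: "s \<in> rmod_hom R (P (n + m)) (P (Suc m))" and t: "t \<in> cob (P m) (n + m)"
    and st: "\<And>x. x \<in> carrier (P (n + m)) \<Longrightarrow> F m x = d m (s x) \<oplus>\<^bsub>P m\<^esub> t x"
    using Suc.IH by blast
  \<comment> \<open>The new correction term is the previous homotopy \<open>s\<close> precomposed
    with the differential. The previous \<open>t\<close> drops out because a coboundary vanishes on
    the image of \<open>d\<close>.\<close>
  let ?c = "\<lambda>x. s (d (n + m) x)"
  have dh: "d (n + m) \<in> rmod_hom R (P (n + Suc m)) (P (n + m))" using d_hom[of "n + m"] by simp
  note c = rmod_hom_comp[OF dh s]
  note cl = rmod_homD(1)[OF F(1)[of "Suc m"]] rmod_homD(1)[OF c] rmod_homD(1)[OF s]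
  have "d m (F (Suc m) x \<ominus>\<^bsub>P (Suc m)\<^esub> ?c x) = \<zero>\<^bsub>P m\<^esub>" if x: "x \<in> carrier (P (n + Suc m))" for x
  proof -
    have dx: "d (n + m) x \<in> carrier (P (n + m))" by (rule rmod_homD(1)[OF dh x])
    have "t (d (n + m) x) = \<zero>\<^bsub>P m\<^esub>" using cob_d[OF term_module t] x by simp
    then have "d m (F (Suc m) x) = d m (?c x)" using F(2)[OF x] st[OF dx] cl(3)[OF dx] by simp
    then show ?thesis using cl(1,2)[OF x] by (simp add: a_minus_def Pm.M.r_neg)
  qed
  from lift_kernel_d[OF term_projective rmod_hom_minus[OF term_module F(1) c] this]
  obtain s' where s': "s' \<in> rmod_hom R (P (n + Suc m)) (P (Suc (Suc m)))"
    "\<And>x. x \<in> carrier (P (n + Suc m)) \<Longrightarrow> d (Suc m) (s' x) = F (Suc m) x \<ominus>\<^bsub>P (Suc m)\<^esub> ?c x" by blast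
  have "F (Suc m) x = d (Suc m) (s' x) \<oplus>\<^bsub>P (Suc m)\<^esub> ?c x" if "x \<in> carrier (P (n + Suc m))" for x
    using cl(1,2)[OF that] s'(2)[OF that] by (simp add: a_minus_def Pm'.M.a_assoc Pm'.M.l_neg)
  moreover have "?c \<in> cob (P (Suc m)) (n + Suc m)"
    using cob_SucI[OF s] by simp
  ultimately show ?case using s'(1) by (intro bexI[of _ s'] bexI[of _ ?c] ballI)
qed

end

section \<open>The weight filtration on Ext\<close>

context graded_resolution
begin

section \<open>Cocycles, their classes and addition in Ext\<close>

lemma cocycleD:
  assumes "f \<in> cocyc n"
  shows "f \<in> rmod_hom R (P n) M" "x \<in> carrier (P n) \<Longrightarrow> f x \<in> carrier M"
    "x \<in> carrier (P (Suc n)) \<Longrightarrow> f (d n x) = \<zero>\<^bsub>M\<^esub>"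
  using assms by (auto simp: ext_cocycles_def dest: rmod_homD(1))

lemma cocycle_zero: "(\<lambda>x. \<zero>\<^bsub>M\<^esub>) \<in> cocyc n"
  by (simp add: ext_cocycles_def rmod_hom_zero_map[OF module_M])

lemma cocycle_add:
  assumes "f \<in> cocyc n" "g \<in> cocyc n" shows "(\<lambda>x. f x \<oplus>\<^bsub>M\<^esub> g x) \<in> cocyc n"
proof -
  interpret right_module R M by (rule module_M)
  show ?thesis using assms by (simp add: ext_cocycles_def rmod_hom_add[OF module_M])
qed

lemma relI:
  assumes "f \<in> cocyc n" "g \<in> cocyc n" "b \<in> cob M n"
    and "\<And>x. x \<in> carrier (P n) \<Longrightarrow> f x = g x \<oplus>\<^bsub>M\<^esub> b x"
  shows "(f, g) \<in> rel n"
  using assms by (auto simp: ext_rel_def)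

lemma relD:
  assumes "(f, g) \<in> rel n"
  shows "f \<in> cocyc n" "g \<in> cocyc n"
    "\<exists>b\<in>cob M n. \<forall>x\<in>carrier (P n). f x = g x \<oplus>\<^bsub>M\<^esub> b x \<and> b x \<in> carrier M"
proof -
  show "f \<in> cocyc n" "g \<in> cocyc n" using assms unfolding ext_rel_def by blast+
  obtain b where b: "b \<in> cob M n" "\<forall>x\<in>carrier (P n). f x = g x \<oplus>\<^bsub>M\<^esub> b x"
    using assms unfolding ext_rel_def by blast
  then show "\<exists>b\<in>cob M n. \<forall>x\<in>carrier (P n). f x = g x \<oplus>\<^bsub>M\<^esub> b x \<and> b x \<in> carrier M"
    using rmod_homD(1)[OF cob_hom[OF module_M b(1)]] by blast
qed

lemma rel_cong:
  assumes "f \<in> cocyc n" "g \<in> cocyc n" "\<And>x. x \<in> carrier (P n) \<Longrightarrow> f x = g x"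
  shows "(f, g) \<in> rel n"
proof -
  interpret right_module R M by (rule module_M)
  show ?thesis
    by (rule relI[OF assms(1,2) cob_zero[OF module_M]]) (use assms cocycleD(2)[OF assms(2)] in simp)
qed

lemma rel_sym: assumes "(f, g) \<in> rel n" shows "(g, f) \<in> rel n"
proof -
  interpret right_module R M by (rule module_M)
  obtain b where b: "f \<in> cocyc n" "g \<in> cocyc n" "b \<in> cob M n"
    "\<And>x. x \<in> carrier (P n) \<Longrightarrow> f x = g x \<oplus>\<^bsub>M\<^esub> b x" "\<And>x. x \<in> carrier (P n) \<Longrightarrow> b x \<in> carrier M"
    using relD[OF assms] by blast
  show ?thesis
    by (rule relI[OF b(2,1) cob_uminus[OF module_M b(3)]])
      (use b(4,5) cocycleD(2)[OF b(2)] in \<open>simp add: M.a_assoc M.r_neg\<close>)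
qed

lemma rel_trans: assumes "(f, g) \<in> rel n" "(g, h) \<in> rel n" shows "(f, h) \<in> rel n"
proof -
  interpret right_module R M by (rule module_M)
  obtain b where b: "f \<in> cocyc n" "g \<in> cocyc n" "b \<in> cob M n"
    "\<And>x. x \<in> carrier (P n) \<Longrightarrow> f x = g x \<oplus>\<^bsub>M\<^esub> b x" "\<And>x. x \<in> carrier (P n) \<Longrightarrow> b x \<in> carrier M"
    using relD[OF assms(1)] by blast
  obtain c where c: "g \<in> cocyc n" "h \<in> cocyc n" "c \<in> cob M n"
    "\<And>x. x \<in> carrier (P n) \<Longrightarrow> g x = h x \<oplus>\<^bsub>M\<^esub> c x" "\<And>x. x \<in> carrier (P n) \<Longrightarrow> c x \<in> carrier M"
    using relD[OF assms(2)] by blast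
  show ?thesis
    by (rule relI[OF b(1) c(2) cob_add[OF module_M c(3) b(3)]])
      (use b(4,5) c(4,5) cocycleD(2)[OF c(2)] in \<open>simp add: M.a_assoc\<close>)
qed

lemma equiv_rel: "equiv (cocyc n) (rel n)"
proof (rule equivI)
  show "rel n \<subseteq> cocyc n \<times> cocyc n" by (auto simp: ext_rel_def)
  show "refl_on (cocyc n) (rel n)" by (auto intro!: refl_onI rel_cong)
  show "sym (rel n)" by (auto intro: symI rel_sym)
  show "trans (rel n)" by (auto intro: transI rel_trans)
qed

lemma class_eqI: "(f, g) \<in> rel n \<Longrightarrow> cls n f = cls n g"
  unfolding ext_class_def by (rule equiv_class_eq[OF equiv_rel])

lemma class_memD: "g \<in> cls n f \<Longrightarrow> (f, g) \<in> rel n"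
  by (simp add: ext_class_def)

lemma class_self: "f \<in> cocyc n \<Longrightarrow> f \<in> cls n f"
  unfolding ext_class_def by (rule equiv_class_self[OF equiv_rel])

lemma class_carrier: "f \<in> cocyc n \<Longrightarrow> cls n f \<in> carrier (Ext n)"
  by (simp add: ext_group_def ext_class_def quotientI)

lemma Ext_carrierE:
  assumes "X \<in> carrier (Ext n)"
  obtains f where "f \<in> cocyc n" "X = cls n f"
  using assms by (auto simp: ext_group_def ext_class_def elim!: quotientE)

lemma Ext_zero: "\<zero>\<^bsub>Ext n\<^esub> = cls n (\<lambda>x. \<zero>\<^bsub>M\<^esub>)"
  by (simp add: ext_group_def)

lemma rel_add:
  assumes "(f, f') \<in> rel n" "(g, g') \<in> rel n"
  shows "((\<lambda>x. f x \<oplus>\<^bsub>M\<^esub> g x), (\<lambda>x. f' x \<oplus>\<^bsub>M\<^esub> g' x)) \<in> rel n"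
proof -
  interpret right_module R M by (rule module_M)
  obtain b where b: "f \<in> cocyc n" "f' \<in> cocyc n" "b \<in> cob M n"
    "\<And>x. x \<in> carrier (P n) \<Longrightarrow> f x = f' x \<oplus>\<^bsub>M\<^esub> b x" "\<And>x. x \<in> carrier (P n) \<Longrightarrow> b x \<in> carrier M"
    using relD[OF assms(1)] by blast
  obtain c where c: "g \<in> cocyc n" "g' \<in> cocyc n" "c \<in> cob M n"
    "\<And>x. x \<in> carrier (P n) \<Longrightarrow> g x = g' x \<oplus>\<^bsub>M\<^esub> c x" "\<And>x. x \<in> carrier (P n) \<Longrightarrow> c x \<in> carrier M"
    using relD[OF assms(2)] by blast
  show ?thesis
    by (rule relI[OF cocycle_add[OF b(1) c(1)] cocycle_add[OF b(2) c(2)] cob_add[OF module_M b(3) c(3)]])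
      (use b(4,5) c(4,5) cocycleD(2)[OF b(2)] cocycleD(2)[OF c(2)] in \<open>simp add: M.a_ac\<close>)
qed

text \<open>By \<open>rel_add\<close> all sets in the defining union agree, and \<open>f\<close> and
  \<open>g\<close> themselves show that the union is not empty.\<close>

lemma Ext_add:
  assumes "f \<in> cocyc n" "g \<in> cocyc n"
  shows "cls n f \<oplus>\<^bsub>Ext n\<^esub> cls n g = cls n (\<lambda>x. f x \<oplus>\<^bsub>M\<^esub> g x)"
proof -
  have 1: "cls n (\<lambda>x. f' x \<oplus>\<^bsub>M\<^esub> g' x) = cls n (\<lambda>x. f x \<oplus>\<^bsub>M\<^esub> g x)"
    if "f' \<in> cls n f" "g' \<in> cls n g" for f' g'
    using class_eqI[OF rel_add[OF class_memD[OF that(1)] class_memD[OF that(2)]]] by simp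
  have "(\<Union>f'\<in>cls n f. \<Union>g'\<in>cls n g. cls n (\<lambda>x. f' x \<oplus>\<^bsub>M\<^esub> g' x)) = cls n (\<lambda>x. f x \<oplus>\<^bsub>M\<^esub> g x)"
    by (rule UN_constant_eq[OF class_self[OF assms(1)]], rule ballI,
        rule UN_constant_eq[OF class_self[OF assms(2)]], rule ballI, rule 1)
  then show ?thesis by (simp add: ext_group_def)
qed

text \<open>These laws allow \<open>finsum\<close> in \<open>Ext n\<close> to be evaluated term by
  term; both the product of \<open>ext_algebra\<close> and \<open>component_sum\<close> are such
  sums.\<close>

lemma abelian_monoid_Ext: "abelian_monoid (Ext n)"
proof (rule abelian_monoidI)
  interpret right_module R M by (rule module_M)
  note c = cocycleD(2)
  show "\<zero>\<^bsub>Ext n\<^esub> \<in> carrier (Ext n)" unfolding Ext_zero by (rule class_carrier[OF cocycle_zero])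
  fix X Y assume "X \<in> carrier (Ext n)" "Y \<in> carrier (Ext n)"
  then obtain f g where fg: "f \<in> cocyc n" "X = cls n f" "g \<in> cocyc n" "Y = cls n g"
    by (auto elim!: Ext_carrierE)
  show "X \<oplus>\<^bsub>Ext n\<^esub> Y \<in> carrier (Ext n)"
    by (simp add: fg Ext_add class_carrier cocycle_add)
  show "X \<oplus>\<^bsub>Ext n\<^esub> Y = Y \<oplus>\<^bsub>Ext n\<^esub> X"
    by (simp add: fg Ext_add) (rule class_eqI, rule rel_cong; simp add: fg cocycle_add c[OF fg(1)] c[OF fg(3)] M.a_comm)
  show "\<zero>\<^bsub>Ext n\<^esub> \<oplus>\<^bsub>Ext n\<^esub> X = X"
    by (simp add: fg Ext_add Ext_zero cocycle_zero)
      (rule class_eqI, rule rel_cong; simp add: fg cocycle_add cocycle_zero c[OF fg(1)])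
  fix Z assume "Z \<in> carrier (Ext n)"
  then obtain h where h: "h \<in> cocyc n" "Z = cls n h" by (auto elim!: Ext_carrierE)
  show "X \<oplus>\<^bsub>Ext n\<^esub> Y \<oplus>\<^bsub>Ext n\<^esub> Z = X \<oplus>\<^bsub>Ext n\<^esub> (Y \<oplus>\<^bsub>Ext n\<^esub> Z)"
    by (simp add: fg h Ext_add cocycle_add)
      (rule class_eqI, rule rel_cong; simp add: fg h cocycle_add c[OF fg(1)] c[OF fg(3)] c[OF h(1)] M.a_assoc)
qed

section \<open>The Yoneda product on representatives\<close>

lemma cocycle_comp_lift:
  assumes "g \<in> cocyc m" "F \<in> chain_lifts R P d e n f"
  shows "(\<lambda>x. g (F m x)) \<in> cocyc (n + m)"
proof -
  have F: "F m \<in> rmod_hom R (P (n + m)) (P m)" "F (Suc m) \<in> rmod_hom R (P (n + Suc m)) (P (Suc m))"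
    "\<And>x. x \<in> carrier (P (n + Suc m)) \<Longrightarrow> d m (F (Suc m) x) = F m (d (n + m) x)"
    using assms(2) unfolding chain_lifts_def by blast+
  have "g (F m (d (n + m) x)) = \<zero>\<^bsub>M\<^esub>" if x: "x \<in> carrier (P (n + Suc m))" for x
    unfolding F(3)[OF x, symmetric] by (rule cocycleD(3)[OF assms(1) rmod_homD(1)[OF F(2) x]])
  then show ?thesis
    using rmod_hom_comp[OF F(1) cocycleD(1)[OF assms(1)]] by (simp add: ext_cocycles_def)
qed

text \<open>A chain map lets the differential pass: \<open>h \<circ> d \<circ> F\<close> becomes
  \<open>h \<circ> F \<circ> d\<close>. The two agree on the carrier only, hence the separate
  witness \<open>c\<close>.\<close>

lemma cob_comp_lift:
  assumes "b \<in> cob M m" "F \<in> chain_lifts R P d e n f"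
  shows "\<exists>c\<in>cob M (n + m). \<forall>x\<in>carrier (P (n + m)). b (F m x) = c x"
  using assms(1)
proof (cases rule: cob_cases)
  case zero
  show ?thesis by (rule bexI[OF _ cob_zero[OF module_M]]) (simp add: zero)
next
  case (Suc m' h)
  have F: "F m' \<in> rmod_hom R (P (n + m')) (P m')"
    "\<And>x. x \<in> carrier (P (n + Suc m')) \<Longrightarrow> d m' (F (Suc m') x) = F m' (d (n + m') x)"
    using assms(2) unfolding chain_lifts_def by blast+
  have "(\<lambda>x. h (F m' (d (n + m') x))) \<in> cob M (n + m)"
    using cob_SucI[OF rmod_hom_comp[OF F(1) Suc(2)]] by (simp add: Suc(1))
  then show ?thesis by (rule bexI[rotated]) (use F(2) in \<open>simp add: Suc(1,3)\<close>)
qed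

text \<open>Independence of both representatives and of the lift at once. The difference of the
  lifts is a chain map over the coboundary \<open>b\<close>, so \<open>chain_map_homotopy\<close>
  writes it as a boundary plus a coboundary, and the cocycle \<open>g\<close> kills the boundary.
  Applied to two lifts of \<open>e\<close>, the lemma compares an endomorphism of \<open>P\<close>
  with the identity.\<close>

lemma yoneda_rel:
  assumes "(g, g') \<in> rel m" "(f, f') \<in> rel n"
    and F: "F \<in> chain_lifts R P d e n f" and F': "F' \<in> chain_lifts R P d e n f'"
  shows "((\<lambda>x. g (F m x)), (\<lambda>x. g' (F' m x))) \<in> rel (n + m)"
proof -
  interpret M: right_module R M by (rule module_M)
  obtain a where a: "g \<in> cocyc m" "g' \<in> cocyc m" "a \<in> cob M m"
    "\<And>x. x \<in> carrier (P m) \<Longrightarrow> g x = g' x \<oplus>\<^bsub>M\<^esub> a x" "\<And>x. x \<in> carrier (P m) \<Longrightarrow> a x \<in> carrier M"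
    using relD[OF assms(1)] by blast
  obtain b where b: "f \<in> cocyc n" "f' \<in> cocyc n" "b \<in> cob M n"
    "\<And>x. x \<in> carrier (P n) \<Longrightarrow> f x = f' x \<oplus>\<^bsub>M\<^esub> b x" "\<And>x. x \<in> carrier (P n) \<Longrightarrow> b x \<in> carrier M"
    using relD[OF assms(2)] by blast
  have FD: "F k \<in> rmod_hom R (P (n + k)) (P k)" "x \<in> carrier (P n) \<Longrightarrow> e (F 0 x) = f x"
    "x \<in> carrier (P (n + Suc k)) \<Longrightarrow> d k (F (Suc k) x) = F k (d (n + k) x)" for k x
    using F by (auto simp: chain_lifts_def)
  have FD': "F' k \<in> rmod_hom R (P (n + k)) (P k)" "x \<in> carrier (P n) \<Longrightarrow> e (F' 0 x) = f' x"
    "x \<in> carrier (P (n + Suc k)) \<Longrightarrow> d k (F' (Suc k) x) = F' k (d (n + k) x)" for k x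
    using F' by (auto simp: chain_lifts_def)
  note cl = rmod_homD(1)[OF FD(1)] rmod_homD(1)[OF FD'(1)]
  define G where "G k x = F k x \<ominus>\<^bsub>P k\<^esub> F' k x" for k x
  have "\<exists>s\<in>rmod_hom R (P (n + m)) (P (Suc m)). \<exists>t\<in>cob (P m) (n + m).
    \<forall>x\<in>carrier (P (n + m)). G m x = d m (s x) \<oplus>\<^bsub>P m\<^esub> t x"
  proof (rule chain_map_homotopy[OF _ _ b(3)])
    show "G k \<in> rmod_hom R (P (n + k)) (P k)" for k
      unfolding G_def by (rule rmod_hom_minus[OF term_module FD(1) FD'(1)])
  next
    fix k x assume x: "x \<in> carrier (P (n + Suc k))"
    interpret d: abelian_group_hom "P (Suc k)" "P k" "d k"
      by (rule rmod_hom_abelian_group_hom[OF d_hom term_module term_module])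
    show "d k (G (Suc k) x) = G k (d (n + k) x)"
      using cl[OF x] FD(3)[OF x] FD'(3)[OF x] by (simp add: G_def a_minus_def)
  next
    fix x assume x: "x \<in> carrier (P n)"
    interpret e: abelian_group_hom "P 0" M e
      by (rule rmod_hom_abelian_group_hom[OF e_hom term_module module_M])
    have "F 0 x \<in> carrier (P 0)" "F' 0 x \<in> carrier (P 0)" using cl[of x 0] x by auto
    then have "e (G 0 x) = f x \<ominus>\<^bsub>M\<^esub> f' x" using FD(2)[OF x] FD'(2)[OF x] by (simp add: G_def a_minus_def)
    also have "\<dots> = b x" using b(4,5)[OF x] cocycleD(2)[OF b(2) x]
      by (simp add: a_minus_def M.M.a_ac M.M.r_neg)
    finally show "e (G 0 x) = b x" .
  qed
  then obtain s t where s: "s \<in> rmod_hom R (P (n + m)) (P (Suc m))" and t: "t \<in> cob (P m) (n + m)"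
    and st: "\<And>x. x \<in> carrier (P (n + m)) \<Longrightarrow> G m x = d m (s x) \<oplus>\<^bsub>P m\<^esub> t x" by blast
  interpret g: abelian_group_hom "P m" M g
    by (rule rmod_hom_abelian_group_hom[OF cocycleD(1)[OF a(1)] term_module module_M])
  have gF: "g (F m x) = g (F' m x) \<oplus>\<^bsub>M\<^esub> g (t x)" if x: "x \<in> carrier (P (n + m))" for x
  proof -
    have c: "F m x \<in> carrier (P m)" "F' m x \<in> carrier (P m)" "s x \<in> carrier (P (Suc m))"
      "t x \<in> carrier (P m)" "d m (s x) \<in> carrier (P m)"
      using cl[OF x] rmod_homD(1)[OF s x] rmod_homD(1)[OF cob_hom[OF term_module t] x] rmod_homD(1)[OF d_hom] by auto
    have "g (G m x) = g (t x)" using c cocycleD(3)[OF a(1), of "s x"] by (simp add: st[OF x])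
    moreover have "g (F m x) = g (F' m x) \<oplus>\<^bsub>M\<^esub> g (G m x)"
      using c by (simp add: G_def a_minus_def M.M.a_ac M.M.r_neg)
    ultimately show ?thesis by simp
  qed
  \<comment> \<open>Passing from \<open>g\<close> to \<open>g'\<close> costs
    \<open>a \<circ> F' m\<close>, which is again a coboundary because \<open>F'\<close> is a chain
    map.\<close>
  obtain c where c: "c \<in> cob M (n + m)" "\<And>x. x \<in> carrier (P (n + m)) \<Longrightarrow> a (F' m x) = c x"
    using cob_comp_lift[OF a(3) F'] by blast
  note gt = cob_comp[OF term_module module_M cocycleD(1)[OF a(1)] t]
  show ?thesis
  proof (rule relI[OF cocycle_comp_lift[OF a(1) F] cocycle_comp_lift[OF a(2) F'] cob_add[OF module_M c(1) gt]])
    fix x assume x: "x \<in> carrier (P (n + m))"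
    have "g (F m x) = g' (F' m x) \<oplus>\<^bsub>M\<^esub> a (F' m x) \<oplus>\<^bsub>M\<^esub> g (t x)"
      using gF[OF x] a(4)[OF cl(2)[OF x]] by simp
    then show "g (F m x) = g' (F' m x) \<oplus>\<^bsub>M\<^esub> (c x \<oplus>\<^bsub>M\<^esub> g (t x))"
      using c(2)[OF x] cocycleD(2)[OF a(2) cl(2)[OF x]] a(5)[OF cl(2)[OF x]] rmod_homD(1)[OF cob_hom[OF module_M gt] x]
      by (simp add: M.M.a_assoc)
  qed
qed

text \<open>By \<open>yoneda_rel\<close> every member of the defining union is the same class; the
  given lift \<open>F\<close> makes the union nonempty.\<close>

lemma yoneda_class:
  assumes "g \<in> cocyc m" "f \<in> cocyc n" "F \<in> chain_lifts R P d e n f"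
  shows "yoneda R M P d e m n (cls m g) (cls n f) = cls (n + m) (\<lambda>x. g (F m x))"
proof -
  have 1: "cls (n + m) (\<lambda>x. g' (F' m x)) = cls (n + m) (\<lambda>x. g (F m x))"
    if "g' \<in> cls m g" "f' \<in> cls n f" "F' \<in> chain_lifts R P d e n f'" for g' f' F'
    using class_eqI[OF yoneda_rel[OF class_memD[OF that(1)] class_memD[OF that(2)] assms(3) that(3)]] by simp
  show ?thesis unfolding yoneda_def
  proof (rule equalityI)
    show "(\<Union>g'\<in>cls m g. \<Union>f'\<in>cls n f. \<Union>F'\<in>chain_lifts R P d e n f'. cls (n + m) (\<lambda>x. g' (F' m x)))
        \<subseteq> cls (n + m) (\<lambda>x. g (F m x))"
      by (intro UN_least) (simp add: 1)
    show "cls (n + m) (\<lambda>x. g (F m x))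
        \<subseteq> (\<Union>g'\<in>cls m g. \<Union>f'\<in>cls n f. \<Union>F'\<in>chain_lifts R P d e n f'. cls (n + m) (\<lambda>x. g' (F' m x)))"
      by (intro subsetI UN_I[OF class_self[OF assms(1)]] UN_I[OF class_self[OF assms(2)]] UN_I[OF assms(3)])
  qed
qed

text \<open>The classes of weight at least \<open>w\<close>: weight is degree plus \<open>n\<close>,
  hence the shift by \<open>n\<close>. One representative satisfying the bound suffices.\<close>

definition ext_filt :: "int \<Rightarrow> nat \<Rightarrow> ('p \<Rightarrow> 'b) set set"
  where "ext_filt w n = {cls n f |f. f \<in> cocyc n \<and> hom_degree_ge (P n) M (w - int n) f}"

lemma ext_filt_carrier: "X \<in> ext_filt w n \<Longrightarrow> X \<in> carrier (Ext n)"
  by (auto simp: ext_filt_def class_carrier)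

lemma ext_filt_zero: "\<zero>\<^bsub>Ext n\<^esub> \<in> ext_filt w n"
proof -
  have "hom_degree_ge (P n) M j (\<lambda>x. \<zero>\<^bsub>M\<^esub>)" for j
    using additive_subgroup.zero_closed[OF gtail_subgroup[OF graded_module_M]] by (auto simp: hom_degree_ge_def)
  then show ?thesis unfolding Ext_zero ext_filt_def using cocycle_zero by blast
qed

lemma ext_filt_add:
  assumes "X \<in> ext_filt w n" "Y \<in> ext_filt w n" shows "X \<oplus>\<^bsub>Ext n\<^esub> Y \<in> ext_filt w n"
proof -
  obtain f g where fg: "f \<in> cocyc n" "hom_degree_ge (P n) M (w - int n) f" "X = cls n f"
    "g \<in> cocyc n" "hom_degree_ge (P n) M (w - int n) g" "Y = cls n g"
    using assms by (auto simp: ext_filt_def)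
  have "hom_degree_ge (P n) M (w - int n) (\<lambda>x. f x \<oplus>\<^bsub>M\<^esub> g x)"
    using fg(2,5) additive_subgroup.a_closed[OF gtail_subgroup[OF graded_module_M]]
    by (auto simp: hom_degree_ge_def image_subset_iff)
  then show ?thesis using fg cocycle_add[OF fg(1,4)] by (auto simp: ext_filt_def Ext_add)
qed

lemma ext_filt_finsum:
  assumes "X \<in> I \<rightarrow> ext_filt w n" shows "finsum (Ext n) X I \<in> ext_filt w n"
proof -
  interpret abelian_monoid "Ext n" by (rule abelian_monoid_Ext)
  show ?thesis using assms
  proof (induction I rule: infinite_finite_induct)
    case (insert i I)
    then have "X \<in> I \<rightarrow> carrier (Ext n)" "X i \<in> carrier (Ext n)"
      using ext_filt_carrier by blast+
    with insert show ?case by (simp add: ext_filt_add Pi_iff)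
  qed (auto simp: ext_filt_zero)
qed

text \<open>From its \<open>n\<close>-th term on, \<open>P\<close> is still a complex of
  projectives, so \<open>ex_chain_lift\<close> applies to the shifted complex.\<close>

lemma ex_filtered_lift:
  assumes "f \<in> cocyc n" "hom_degree_ge (P n) M j f"
  shows "\<exists>F\<in>chain_lifts R P d e n f. \<forall>k. hom_degree_ge (P (n + k)) (P k) j (F k)"
proof -
  have "\<exists>F. (\<forall>k. F k \<in> rmod_hom R (P (n + k)) (P k)) \<and> (\<forall>k. hom_degree_ge (P (n + k)) (P k) j (F k)) \<and>
    (\<forall>x\<in>carrier (P (n + 0)). e (F 0 x) = f x) \<and>
    (\<forall>k. \<forall>x\<in>carrier (P (n + Suc k)). d k (F (Suc k) x) = F k (d (n + k) x))"
    by (rule ex_chain_lift[where D = "\<lambda>k. P (n + k)" and \<delta> = "\<lambda>k. d (n + k)"])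
      (use assms(2) cocycleD[OF assms(1)] in \<open>simp_all add: term_graded term_projective d_hom d_degree d_d\<close>)
  then show ?thesis by (auto simp: chain_lifts_def)
qed

text \<open>With a lift of the second factor obeying the same bound, the bounds \<open>w - n\<close>
  and \<open>v - m\<close> add under composition.\<close>

lemma ext_filt_yoneda:
  assumes "X \<in> ext_filt v m" "Y \<in> ext_filt w n"
  shows "yoneda R M P d e m n X Y \<in> ext_filt (v + w) (n + m)"
proof -
  obtain f g where g: "g \<in> cocyc m" "hom_degree_ge (P m) M (v - int m) g" "X = cls m g"
    and f: "f \<in> cocyc n" "hom_degree_ge (P n) M (w - int n) f" "Y = cls n f"
    using assms by (auto simp: ext_filt_def)
  obtain F where F: "F \<in> chain_lifts R P d e n f" "\<And>k. hom_degree_ge (P (n + k)) (P k) (w - int n) (F k)"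
    using ex_filtered_lift[OF f(1,2)] by blast
  have "hom_degree_ge (P (n + m)) M (w - int n + (v - int m)) (\<lambda>x. g (F m x))"
    by (rule hom_degree_ge_comp[OF term_graded graded_module_M cocycleD(1)[OF g(1)] F(2) g(2)])
  moreover have "w - int n + (v - int m) = v + w - int (n + m)" by simp
  ultimately show ?thesis unfolding g(3) f(3) yoneda_class[OF g(1) f(1) F(1)] ext_filt_def
    using cocycle_comp_lift[OF g(1) F(1)] by auto
qed

text \<open>Pulled back to the linear resolution \<open>Q\<close>, the cocycle is zero as a map, not
  merely up to coboundaries; the comparison maps carry this back to \<open>P\<close>.\<close>

lemma ext_filt_eq_zero:
  fixes Q :: "nat \<Rightarrow> ('a, 't, 's) grmodule_scheme"
  assumes Q: "graded_projective_resolution R M Q dQ eQ" "\<And>n. generated_in_degree R (Q n) (int n)"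
    and w: "gtail M w = {\<zero>\<^bsub>M\<^esub>}" and X: "X \<in> ext_filt w n"
  shows "X = \<zero>\<^bsub>Ext n\<^esub>"
proof -
  interpret Q: graded_resolution K R M Q dQ eQ
    by (rule graded_resolution.intro[OF graded_algebra graded_module_M Q(1)])
  obtain f where f: "f \<in> cocyc n" "hom_degree_ge (P n) M (w - int n) f" "X = cls n f"
    using X by (auto simp: ext_filt_def)
  have "\<exists>F. (\<forall>k. F k \<in> rmod_hom R (P k) (Q k)) \<and> (\<forall>k. hom_degree_ge (P k) (Q k) 0 (F k)) \<and>
    (\<forall>x\<in>carrier (P 0). eQ (F 0 x) = e x) \<and>
    (\<forall>k. \<forall>x\<in>carrier (P (Suc k)). dQ k (F (Suc k) x) = F k (d k x))"
    by (rule Q.ex_chain_lift)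
      (auto simp: term_graded term_projective d_hom d_degree d_d e_hom e_d
        intro: hom_degree_imp_ge[OF graded_module_M e_degree])
  then obtain \<alpha> where \<alpha>: "\<And>k. \<alpha> k \<in> rmod_hom R (P k) (Q k)" "\<And>x. x \<in> carrier (P 0) \<Longrightarrow> eQ (\<alpha> 0 x) = e x"
    "\<And>k x. x \<in> carrier (P (Suc k)) \<Longrightarrow> dQ k (\<alpha> (Suc k) x) = \<alpha> k (d k x)"
    by blast
  have "\<exists>F. (\<forall>k. F k \<in> rmod_hom R (Q k) (P k)) \<and> (\<forall>k. hom_degree_ge (Q k) (P k) 0 (F k)) \<and>
    (\<forall>x\<in>carrier (Q 0). e (F 0 x) = eQ x) \<and>
    (\<forall>k. \<forall>x\<in>carrier (Q (Suc k)). d k (F (Suc k) x) = F k (dQ k x))"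
    by (rule ex_chain_lift)
      (auto simp: Q.term_graded Q.term_projective Q.d_hom Q.d_degree Q.d_d Q.e_hom Q.e_d
        intro: hom_degree_imp_ge[OF graded_module_M Q.e_degree])
  then obtain \<beta> where \<beta>: "\<And>k. \<beta> k \<in> rmod_hom R (Q k) (P k)" "\<And>k. hom_degree_ge (Q k) (P k) 0 (\<beta> k)"
    "\<And>x. x \<in> carrier (Q 0) \<Longrightarrow> e (\<beta> 0 x) = eQ x"
    "\<And>k x. x \<in> carrier (Q (Suc k)) \<Longrightarrow> d k (\<beta> (Suc k) x) = \<beta> k (dQ k x)"
    by blast
  have f\<beta>: "(\<lambda>y. f (\<beta> n y)) \<in> rmod_hom R (Q n) M"
    by (rule rmod_hom_comp[OF \<beta>(1) cocycleD(1)[OF f(1)]])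
  interpret f\<beta>: abelian_group_hom "Q n" M "\<lambda>y. f (\<beta> n y)"
    by (rule rmod_hom_abelian_group_hom[OF f\<beta> Q.term_module module_M])
  interpret M: right_module R M by (rule module_M)
  interpret Qn: right_module R "Q n" by (rule Q.term_module)
  \<comment> \<open>The generators of \<open>Q n\<close> sit in degree \<open>n\<close>, and
    \<open>f \<circ> \<beta> n\<close> raises degrees by at least \<open>w - n\<close>, so their
    images lie in degrees at least \<open>w\<close>, where \<open>M\<close> vanishes.\<close>
  have "f (\<beta> n y) = \<zero>\<^bsub>M\<^esub>" if "y \<in> gcomp (Q n) (int n)" for y
  proof -
    have "hom_degree_ge (Q n) M (0 + (w - int n)) (\<lambda>y. f (\<beta> n y))"
      by (rule hom_degree_ge_comp[OF term_graded graded_module_M cocycleD(1)[OF f(1)] \<beta>(2) f(2)])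
    then show ?thesis using that w by (fastforce simp: hom_degree_ge_def)
  qed
  moreover have "rsubmodule R (Q n) {y \<in> carrier (Q n). f (\<beta> n y) = \<zero>\<^bsub>M\<^esub>}"
    unfolding rsubmodule_def
  proof (intro conjI ballI)
    show "additive_subgroup {y \<in> carrier (Q n). f (\<beta> n y) = \<zero>\<^bsub>M\<^esub>} (Q n)"
      using f\<beta>.additive_subgroup_a_kernel unfolding a_kernel_def' .
  next
    fix y r assume "y \<in> {y \<in> carrier (Q n). f (\<beta> n y) = \<zero>\<^bsub>M\<^esub>}" "r \<in> carrier R"
    then show "y \<cdot>\<^bsub>Q n\<^esub> r \<in> {y \<in> carrier (Q n). f (\<beta> n y) = \<zero>\<^bsub>M\<^esub>}"
      using rmod_homD(3)[OF f\<beta>] M.rsmult_zero_left Qn.rsmult_closed by simp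
  qed
  ultimately have "rspan R (Q n) (gcomp (Q n) (int n)) \<subseteq> {y \<in> carrier (Q n). f (\<beta> n y) = \<zero>\<^bsub>M\<^esub>}"
    unfolding rspan_def using graded_moduleD(5)[OF Q.term_graded] by (intro Inter_lower) auto
  then have f\<beta>0: "f (\<beta> n y) = \<zero>\<^bsub>M\<^esub>" if "y \<in> carrier (Q n)" for y
    using Q(2)[of n] that by (auto simp: generated_in_degree_def)
  \<comment> \<open>Both \<open>\<beta> \<circ> \<alpha>\<close> and the identity lift the 0-cocycle
    \<open>e\<close>, so \<open>yoneda_rel\<close> identifies the class of
    \<open>f \<circ> \<beta> n \<circ> \<alpha> n\<close> with that of \<open>f\<close>.\<close>
  have ba: "(\<lambda>k x. \<beta> k (\<alpha> k x)) \<in> chain_lifts R P d e 0 e"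
    using rmod_hom_comp[OF \<alpha>(1) \<beta>(1)] \<alpha>(2,3) \<beta>(3,4) rmod_homD(1)[OF \<alpha>(1)] by (auto simp: chain_lifts_def)
  have "(\<lambda>k x. x) \<in> chain_lifts R P d e 0 e"
    by (auto simp: chain_lifts_def rmod_hom_def)
  moreover have "(f, f) \<in> rel n" by (rule rel_cong[OF f(1) f(1)]) simp
  moreover have "(e, e) \<in> rel 0" by (rule rel_cong) (auto simp: ext_cocycles_def e_hom e_d)
  ultimately have 1: "((\<lambda>x. f (\<beta> n (\<alpha> n x))), f) \<in> rel n"
    using yoneda_rel[OF _ _ ba, of f f n e "\<lambda>k x. x"] by simp
  have 2: "((\<lambda>x. \<zero>\<^bsub>M\<^esub>), (\<lambda>x. f (\<beta> n (\<alpha> n x)))) \<in> rel n"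
    by (rule rel_cong[OF cocycle_zero relD(1)[OF 1]]) (simp add: f\<beta>0 rmod_homD(1)[OF \<alpha>(1)])
  show ?thesis unfolding f(3) Ext_zero by (rule class_eqI[OF rel_trans[OF 2 1], symmetric])
qed

text \<open>Degrees are integers, so \<open>- n < i\<close> means \<open>1 - n \<le> i\<close>, that
  is, weight at least 1. The filtration absorbs the sum over the degrees.\<close>

lemma ext_N_filt:
  assumes "\<xi> \<in> ext_N R M P d e" shows "\<xi> n \<in> ext_filt 1 n"
proof -
  have sub: "ext_degree R M P d n i \<subseteq> ext_filt 1 n" if i: "- int n < i" for i
  proof
    fix X assume "X \<in> ext_degree R M P d n i"
    then obtain f where f: "f \<in> cocyc n" "hom_degree (P n) M i f" "X = cls n f"
      unfolding ext_degree_def by blast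
    have "hom_degree_ge (P n) M (1 - int n) f"
      by (rule hom_degree_imp_ge[OF graded_module_M f(2)]) (use i in simp)
    then show "X \<in> ext_filt 1 n" using f(1,3) unfolding ext_filt_def by blast
  qed
  have "\<xi> n \<in> component_sum (Ext n) (ext_degree R M P d n) {i. - int n < i}"
    using assms unfolding ext_N_def by blast
  then obtain S c where c: "S \<subseteq> {i. - int n < i}" "\<forall>i\<in>S. c i \<in> ext_degree R M P d n i"
    "\<xi> n = finsum (Ext n) c S"
    unfolding component_sum_def by blast
  have "c \<in> S \<rightarrow> ext_filt 1 n" using c(1,2) sub by blast
  then show ?thesis unfolding c(3) by (rule ext_filt_finsum)
qed

lemma pow_filt:
  assumes "\<And>n. \<xi> n \<in> ext_filt 1 n"
  shows "(\<xi> [^]\<^bsub>ext_algebra R M P d e\<^esub> (k::nat)) n \<in> ext_filt (int k) n"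
proof (induction k arbitrary: n)
  case 0
  \<comment> \<open>The zeroth power is the identity: it is the class of \<open>e\<close> in
    \<open>Ext 0\<close>, of weight 0, and zero in all other \<open>Ext n\<close>.\<close>
  have "cls 0 e \<in> ext_filt 0 0"
    using e_hom e_d hom_degree_imp_ge[OF graded_module_M e_degree] by (auto simp: ext_filt_def ext_cocycles_def)
  then show ?case by (simp add: nat_pow_def ext_algebra_def ext_filt_zero)
next
  case (Suc k)
  \<comment> \<open>In cohomological degree \<open>n\<close> the product of the \<open>k\<close>-th
    power with \<open>\<xi>\<close> is the sum of these terms over \<open>m \<le> n\<close>, each of
    weight at least \<open>k + 1\<close>.\<close>
  have "yoneda R M P d e m (n - m) ((\<xi> [^]\<^bsub>ext_algebra R M P d e\<^esub> k) m) (\<xi> (n - m)) \<in> ext_filt (int (Suc k)) n"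
    if "m \<le> n" for m
    using ext_filt_yoneda[OF Suc.IH[of m] assms[of "n - m"]] that by (simp add: add.commute)
  then show ?case
    by (auto simp: nat_pow_def ext_algebra_def intro!: ext_filt_finsum)
qed

end

section \<open>Nilpotency of the elements of \<open>ext_N\<close>\<close>

theorem proposition2p4:
  fixes K :: "('k, 'l) ring_scheme"
    and R :: "('k, 'a, 'r) gralg_scheme"
    and M :: "('a, 'b, 'm) grmodule_scheme"
    and P :: "nat \<Rightarrow> ('a, 'p, 'q) grmodule_scheme"
    and d :: "nat \<Rightarrow> 'p \<Rightarrow> 'p"
    and e :: "'p \<Rightarrow> 'b"
    and l :: nat
  assumes "koszul_algebra TYPE('s) K R"
    and "linear_module TYPE('t) R M"
    and "graded_length M l"
    and "minimal_graded_projective_resolution R M P d e"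
  shows "\<forall>\<xi>\<in>ext_N R M P d e. \<exists>k::nat. 0 < k \<and>
    \<xi> [^]\<^bsub>ext_algebra R M P d e\<^esub> k = \<zero>\<^bsub>ext_algebra R M P d e\<^esub>"
proof
  fix \<xi> assume \<xi>: "\<xi> \<in> ext_N R M P d e"
  interpret graded_resolution K R M P d e
    by (rule graded_resolution.intro)
      (use assms in \<open>auto simp: koszul_algebra_def linear_module_def minimal_graded_projective_resolution_def\<close>)
  obtain Q :: "nat \<Rightarrow> ('a, 't) grmodule" and dQ eQ where
    Q: "graded_projective_resolution R M Q dQ eQ" "\<And>n. generated_in_degree R (Q n) (int n)"
    using assms(2) by (auto simp: linear_module_def)
  obtain b where b: "\<And>i. b < i \<Longrightarrow> gcomp M i = {\<zero>\<^bsub>M\<^esub>}"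
    using assms(3) by (auto simp: graded_length_def)
  \<comment> \<open>A positive exponent above the top degree \<open>b\<close>, also when
    \<open>b\<close> is negative: the \<open>k\<close>-th power then has weight beyond every degree
    in which \<open>M\<close> is nonzero.\<close>
  define k where "k = Suc (nat b)"
  \<comment> \<open>The zero set is a subgroup because it is the component of \<open>M\<close> in
    degree \<open>b + 1\<close>.\<close>
  have "additive_subgroup {\<zero>\<^bsub>M\<^esub>} M"
    using additive_subgroupI'[of M "{\<zero>\<^bsub>M\<^esub>}"] graded_moduleD(4)[OF graded_module_M, of "b + 1"] b by simp
  then have "gtail M (int k) \<subseteq> {\<zero>\<^bsub>M\<^esub>}"
  proof (rule gtail_subset[OF graded_module_M])
    fix i assume "int k \<le> i"
    then have "b < i" by (simp add: k_def split: if_splits)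
    then show "gcomp M i \<subseteq> {\<zero>\<^bsub>M\<^esub>}" by (simp add: b)
  qed
  then have "gtail M (int k) = {\<zero>\<^bsub>M\<^esub>}"
    using additive_subgroup.zero_closed[OF gtail_subgroup[OF graded_module_M]] by blast
  from ext_filt_eq_zero[OF Q this pow_filt[OF ext_N_filt[OF \<xi>]]]
  have "\<xi> [^]\<^bsub>ext_algebra R M P d e\<^esub> k = \<zero>\<^bsub>ext_algebra R M P d e\<^esub>"
    by (auto simp: ext_algebra_def)
  then show "\<exists>k::nat. 0 < k \<and> \<xi> [^]\<^bsub>ext_algebra R M P d e\<^esub> k = \<zero>\<^bsub>ext_algebra R M P d e\<^esub>"
    by (intro exI[of _ k]) (simp add: k_def)
qed

end
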